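(* For any $l\in\mathbb{N}_0$, any $t\in\mathbb{R}^+$ that is a multiple of $\Delta_l$, and any $k_1\in\{0,1,\dots,\Delta_l^{-1}\}$, almost surely $$ \lim_{N\rightarrow\infty}\left(\eta_{t+k_1\Delta_l}^{N,l}(e)-\eta_{t+k_1\Delta_l}^l(e)\right) = 0 , $$ where $\eta^{N,l}_{t}(e)=\frac1N\sum_{i=1}^N\xi^i_t$ is the mean of the discretized ensemble Kalman--Bucy particle system and $\eta_t^l$ is the Gaussian law $\mathcal{N}_{d_x}(m_t,P_t)$ of the discretized Kalman--Bucy recursions, as defined in the context.
   Context: Model. Fix $d_x,d_y\in\mathbb{N}$, a $d_x\times d_x$ real matrix $A$, a $d_y\times d_x$ real matrix $C$, and symmetric invertible matrices $R_1^{1/2}$ ($d_x\times d_x$) and $R_2^{1/2}$ ($d_y\times d_y$); $R_i=(R_i^{1/2})^2$, $S=C^{\top}R_2^{-1}C$. The signal and observations satisfy $dX_t=AX_tdt+R_1^{1/2}dW_t$, $dY_t=CX_tdt+R_2^{1/2}dV_t$, $Y_0=0$, $X_0\sim\mathcal{N}_{d_x}(\mathcal{M}_0,\mathcal{P}_0)$, with $(V,W)$ a standard $(d_y+d_x)$-dimensional Brownian motion independent of $X_0$. $\mathbb{N}_0=\mathbb{N}\cup\{0\}$, $\Delta_l=2^{-l}$, $e(x)=x$, and $\pi(\varphi)$ denotes the integral of $\varphi$ with respect to $\pi$. Particle system. Fix $l\in\mathbb{N}_0$. Let $(\overline{W}^i,\overline{V}^i)_{i\ge1}$ be independent standard Brownian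 motions of dimensions $d_x$ and $d_y$, and $\xi_0^i$, $i\geq 1$, i.i.d. $\mathcal{N}_{d_x}(\mathcal{M}_0,\mathcal{P}_0)$, all independent of each other and of $(X_0,W,V)$. For $N\ge2$, $i\in\{1,\dots,N\}$, $k\in\mathbb{N}_0$, $$\xi_{(k+1)\Delta_l}^i=\xi_{k\Delta_l}^i+A\xi_{k\Delta_l}^i\Delta_l+R_1^{1/2}[\overline{W}^i_{(k+1)\Delta_l}-\overline{W}^i_{k\Delta_l}]+P^N_{k\Delta_l}C^{\top}R_2^{-1}\Big([Y_{(k+1)\Delta_l}-Y_{k\Delta_l}]-\big[C\xi_{k\Delta_l}^i\Delta_l+R_2^{1/2}[\overline{V}^i_{(k+1)\Delta_l}-\overline{V}^i_{k\Delta_l}]\big]\Big),$$ with $m^N_{k\Delta_l}=\frac1N\sum_{i=1}^N\xi^i_{k\Delta_l}$ and $P^N_{k\Delta_l}=\frac1{N-1}\sum_{i=1}^N(\xi^i_{k\Delta_l}-m^N_{k\Delta_l})(\xi^i_{k\Delta_l}-m^N_{k\Delta_l})^{\top}$ (the particles depend on $N$; this is suppressed). $\eta_t^{N,l}$ is the empirical measure of $(\xi_t^1,\dots,\xi_t^N)$ for $t\in\{0,\Delta_l,2\Delta_l,\dots\}$. Limit. $\eta^l_{k\Delta_l}$ is the Gaussian measure $\mathcal{N}_{d_x}(m_{k\Delta_l},P_{k\Delta_l})$, where $m_0=\mathcal{M}_0$, $P_0=\mathcal{P}_0$ and $$m_{(k+1)\Delta_l}=m_{k\Delta_l}+Am_{k\Delta_l}\Delta_l+P_{k\Delta_l}C^{\top}R_2^{-1}\big([Y_{(k+1)\Delta_l}-Y_{k\Delta_l}]-Cm_{k\Delta_l}\Delta_l\big),$$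 $$P_{(k+1)\Delta_l}=P_{k\Delta_l}+\mathrm{Ricc}(P_{k\Delta_l})\Delta_l+(A-P_{k\Delta_l}S)P_{k\Delta_l}(A^{\top}-SP_{k\Delta_l})\Delta_l^2,$$ with $\mathrm{Ricc}(Q)=AQ+QA^{\top}-QSQ+R_1$. So $\eta^l_{k\Delta_l}(e)=m_{k\Delta_l}$. Standing assumptions. (1) $\mu(A)<0$, where $\mu(B)$ is the largest eigenvalue of $\frac12(B+B^{\top})$. (2) There is a finite constant bounding $|P_{k\Delta_l}(j_1,j_2)|$ (computed with step $\Delta_l$) for all $(k,l)\in\mathbb{N}_0^2$ and all $(j_1,j_2)\in\{1,\dots,d_x\}^2$. *)

theory Defs
  imports "HOL-Probability.Probability"
begin

section \<open>Matrices\<close>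

definition outer_product :: "real^'m \<Rightarrow> real^'n \<Rightarrow> real^'n^'m" where
  "outer_product u v = (\<chi> a b. u $ a * v $ b)"

definition sym_psd :: "real^'n^'n \<Rightarrow> bool" where
  "sym_psd P \<longleftrightarrow> transpose P = P \<and> (\<forall>u. 0 \<le> u \<bullet> (P *v u))"

definition real_eigenvalues :: "real^'n^'n \<Rightarrow> real set" where
  "real_eigenvalues B = {c. \<exists>v. v \<noteq> 0 \<and> B *v v = c *\<^sub>R v}"

text \<open>The matrix below is symmetric, so its set of real eigenvalues is its whole spectrum; that set
  is finite and nonempty, so \<open>Max\<close> is meaningful.\<close>

definition log_norm :: "real^'n^'n \<Rightarrow> real" where
  "log_norm B = Max (real_eigenvalues ((1/2) *\<^sub>R (B + transpose B)))"


section \<open>Gaussian measures and Brownian motion\<close>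

definition std_gaussian :: "(real^'n) measure" where
  "std_gaussian = distr (\<Pi>\<^sub>M i\<in>(UNIV :: 'n set). density lborel (\<lambda>x. ennreal (std_normal_density x)))
     borel (\<lambda>z. \<chi> i. z i)"

text \<open>\<open>N(m, P)\<close> is the law of \<open>m + L Z\<close> with \<open>Z\<close> standard Gaussian and \<open>L L\<^sup>T = P\<close>. Such an \<open>L\<close>
  exists exactly when \<open>P\<close> is symmetric positive semidefinite (\<open>P\<close> may be singular), and the law does
  not depend on which \<open>L\<close> is chosen.\<close>

definition gaussian_measure :: "real^'n \<Rightarrow> real^'n^'n \<Rightarrow> (real^'n) measure" where
  "gaussian_measure m P =
     (let L = (SOME L :: real^'n^'n. L ** transpose L = P)
      in distr std_gaussian borel (\<lambda>z. m + L *v z))"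

definition standard_brownian_motion :: "'a measure \<Rightarrow> (real \<Rightarrow> 'a \<Rightarrow> real^'n) \<Rightarrow> bool" where
  "standard_brownian_motion M W \<longleftrightarrow>
     (\<forall>t\<ge>0. W t \<in> borel_measurable M) \<and>
     (AE \<omega> in M. W 0 \<omega> = 0) \<and>
     (AE \<omega> in M. continuous_on {0..} (\<lambda>t. W t \<omega>)) \<and>
     (\<forall>s t. 0 \<le> s \<and> s < t \<longrightarrow>
        distr M borel (\<lambda>\<omega>. W t \<omega> - W s \<omega>) = gaussian_measure 0 ((t - s) *\<^sub>R mat 1)) \<and>
     (\<forall>(\<tau> :: nat \<Rightarrow> real) n. mono \<tau> \<and> 0 \<le> \<tau> 0 \<longrightarrow>
        prob_space.indep_vars M (\<lambda>_. borel) (\<lambda>j \<omega>. W (\<tau> (Suc j)) \<omega> - W (\<tau> j) \<omega>) {..<n})"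

definition joint_process ::
  "(real \<Rightarrow> 'a \<Rightarrow> real^'m) \<Rightarrow> (real \<Rightarrow> 'a \<Rightarrow> real^'n) \<Rightarrow> real \<Rightarrow> 'a \<Rightarrow> real^('m + 'n)" where
  "joint_process V W t \<omega> = (\<chi> j. case j of Inl a \<Rightarrow> V t \<omega> $ a | Inr b \<Rightarrow> W t \<omega> $ b)"

definition generated_algebra ::
  "'a measure \<Rightarrow> 'i set \<Rightarrow> ('i \<Rightarrow> 'a \<Rightarrow> 'b::topological_space) \<Rightarrow> 'a set set" where
  "generated_algebra M I Z =
     sigma_sets (space M) {Z i -` B \<inter> space M | i B. i \<in> I \<and> B \<in> sets borel}"


section \<open>Signal and observations\<close>

text \<open>The noise is additive, so the stochastic integrals are \<open>R1h W\<^sub>t\<close> and \<open>R2h V\<^sub>t\<close>. Here and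
  below \<open>R1h\<close>, \<open>R2h\<close> are the square roots of \<open>R\<^sub>1\<close>, \<open>R\<^sub>2\<close>.\<close>

definition signal_observation ::
  "'a measure \<Rightarrow> real^'x^'x \<Rightarrow> real^'x^'y \<Rightarrow> real^'x^'x \<Rightarrow> real^'y^'y
   \<Rightarrow> (real \<Rightarrow> 'a \<Rightarrow> real^'x) \<Rightarrow> (real \<Rightarrow> 'a \<Rightarrow> real^'y)
   \<Rightarrow> (real \<Rightarrow> 'a \<Rightarrow> real^'x) \<Rightarrow> (real \<Rightarrow> 'a \<Rightarrow> real^'y) \<Rightarrow> bool" where
  "signal_observation M A C R1h R2h W V X Y \<longleftrightarrow>
     (\<forall>t\<ge>0. X t \<in> borel_measurable M \<and> Y t \<in> borel_measurable M) \<and>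
     (AE \<omega> in M.
        continuous_on {0..} (\<lambda>t. X t \<omega>) \<and> Y 0 \<omega> = 0 \<and>
        (\<forall>t\<ge>0. X t \<omega> = X 0 \<omega> + integral {0..t} (\<lambda>s. A *v X s \<omega>) + R1h *v W t \<omega> \<and>
               Y t \<omega> = Y 0 \<omega> + integral {0..t} (\<lambda>s. C *v X s \<omega>) + R2h *v V t \<omega>))"

text \<open>The members of the mutually independent family: the triple \<open>(X\<^sub>0, W, V)\<close> counts as one member,
  and each particle contributes its two Brownian motions and its initial state.\<close>

datatype source = Signal | State_Noise nat | Obs_Noise nat | Initial nat

primrec source_algebra ::
  "'a measure \<Rightarrow> (real \<Rightarrow> 'a \<Rightarrow> real^'x) \<Rightarrow> (real \<Rightarrow> 'a \<Rightarrow> real^'x) \<Rightarrow> (real \<Rightarrow> 'a \<Rightarrow> real^'y)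
   \<Rightarrow> (nat \<Rightarrow> real \<Rightarrow> 'a \<Rightarrow> real^'x) \<Rightarrow> (nat \<Rightarrow> real \<Rightarrow> 'a \<Rightarrow> real^'y) \<Rightarrow> (nat \<Rightarrow> 'a \<Rightarrow> real^'x)
   \<Rightarrow> source \<Rightarrow> 'a set set" where
  "source_algebra M X W V Wb Vb \<xi>0 Signal =
     sigma_sets (space M)
       (generated_algebra M {0} X \<union> generated_algebra M {0..} W \<union> generated_algebra M {0..} V)"
| "source_algebra M X W V Wb Vb \<xi>0 (State_Noise i) = generated_algebra M {0..} (Wb i)"
| "source_algebra M X W V Wb Vb \<xi>0 (Obs_Noise i) = generated_algebra M {0..} (Vb i)"
| "source_algebra M X W V Wb Vb \<xi>0 (Initial i) = generated_algebra M {i} \<xi>0"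


section \<open>Time grid\<close>

definition mesh :: "nat \<Rightarrow> real" where
  "mesh l = 1 / 2 ^ l"

text \<open>For \<open>t = k \<Delta>\<^sub>l\<close> this is \<open>k\<close>; it is only used at such times.\<close>

definition grid_index :: "nat \<Rightarrow> real \<Rightarrow> nat" where
  "grid_index l t = nat \<lfloor>t / mesh l\<rfloor>"

definition grid_increment :: "nat \<Rightarrow> (real \<Rightarrow> 'b::ab_group_add) \<Rightarrow> nat \<Rightarrow> 'b" where
  "grid_increment l z k = z (real (k + 1) * mesh l) - z (real k * mesh l)"


section \<open>Particle system\<close>

definition sample_mean :: "nat \<Rightarrow> (nat \<Rightarrow> real^'x) \<Rightarrow> real^'x" where
  "sample_mean N x = (1 / real N) *\<^sub>R (\<Sum>i=1..N. x i)"

definition sample_cov :: "nat \<Rightarrow> (nat \<Rightarrow> real^'x) \<Rightarrow> real^'x^'x" where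
  "sample_cov N x = (1 / (real N - 1)) *\<^sub>R
     (\<Sum>i=1..N. outer_product (x i - sample_mean N x) (x i - sample_mean N x))"

text \<open>\<open>enkf_particles A C R1h R2h l N y w v x0 k i\<close> is \<open>\<xi>\<^sup>i\<close> at time \<open>k \<Delta>\<^sub>l\<close> in the system of \<open>N\<close>
  particles, along the observation path \<open>y\<close>, noise paths \<open>w i\<close>, \<open>v i\<close> and initial states \<open>x0 i\<close>.
  Only \<open>i \<in> {1..N}\<close> matters.\<close>

primrec enkf_particles ::
  "real^'x^'x \<Rightarrow> real^'x^'y \<Rightarrow> real^'x^'x \<Rightarrow> real^'y^'y \<Rightarrow> nat \<Rightarrow> nat
   \<Rightarrow> (real \<Rightarrow> real^'y) \<Rightarrow> (nat \<Rightarrow> real \<Rightarrow> real^'x) \<Rightarrow> (nat \<Rightarrow> real \<Rightarrow> real^'y)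
   \<Rightarrow> (nat \<Rightarrow> real^'x) \<Rightarrow> nat \<Rightarrow> nat \<Rightarrow> real^'x" where
  "enkf_particles A C R1h R2h l N y w v x0 0 = x0"
| "enkf_particles A C R1h R2h l N y w v x0 (Suc k) =
     (let x = enkf_particles A C R1h R2h l N y w v x0 k;
          P = sample_cov N x
      in (\<lambda>i. x i + mesh l *\<^sub>R (A *v x i) + R1h *v grid_increment l (w i) k
            + (P ** transpose C ** matrix_inv (R2h ** R2h)) *v
                (grid_increment l y k
                  - (mesh l *\<^sub>R (C *v x i) + R2h *v grid_increment l (v i) k))))"

definition empirical_measure :: "nat \<Rightarrow> (nat \<Rightarrow> real^'x) \<Rightarrow> (real^'x) measure" where
  "empirical_measure N x = distr (uniform_count_measure {1..N}) borel x"

definition enkf_law ::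
  "real^'x^'x \<Rightarrow> real^'x^'y \<Rightarrow> real^'x^'x \<Rightarrow> real^'y^'y \<Rightarrow> nat \<Rightarrow> nat
   \<Rightarrow> (real \<Rightarrow> real^'y) \<Rightarrow> (nat \<Rightarrow> real \<Rightarrow> real^'x) \<Rightarrow> (nat \<Rightarrow> real \<Rightarrow> real^'y)
   \<Rightarrow> (nat \<Rightarrow> real^'x) \<Rightarrow> real \<Rightarrow> (real^'x) measure" where
  "enkf_law A C R1h R2h l N y w v x0 t =
     empirical_measure N (enkf_particles A C R1h R2h l N y w v x0 (grid_index l t))"


section \<open>Discretized Kalman--Bucy recursions\<close>

definition obs_information :: "real^'x^'y \<Rightarrow> real^'y^'y \<Rightarrow> real^'x^'x" where
  "obs_information C R2h = transpose C ** matrix_inv (R2h ** R2h) ** C"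

definition Ricc ::
  "real^'x^'x \<Rightarrow> real^'x^'y \<Rightarrow> real^'x^'x \<Rightarrow> real^'y^'y \<Rightarrow> real^'x^'x \<Rightarrow> real^'x^'x" where
  "Ricc A C R1h R2h Q =
     A ** Q + Q ** transpose A - Q ** obs_information C R2h ** Q + R1h ** R1h"

primrec kb_cov ::
  "real^'x^'x \<Rightarrow> real^'x^'y \<Rightarrow> real^'x^'x \<Rightarrow> real^'y^'y \<Rightarrow> real^'x^'x \<Rightarrow> nat
   \<Rightarrow> nat \<Rightarrow> real^'x^'x" where
  "kb_cov A C R1h R2h P0 l 0 = P0"
| "kb_cov A C R1h R2h P0 l (Suc k) =
     (let P = kb_cov A C R1h R2h P0 l k; S = obs_information C R2h
      in P + mesh l *\<^sub>R Ricc A C R1h R2h P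
           + (mesh l)\<^sup>2 *\<^sub>R ((A - P ** S) ** P ** (transpose A - S ** P)))"

primrec kb_mean ::
  "real^'x^'x \<Rightarrow> real^'x^'y \<Rightarrow> real^'x^'x \<Rightarrow> real^'y^'y \<Rightarrow> real^'x \<Rightarrow> real^'x^'x \<Rightarrow> nat
   \<Rightarrow> (real \<Rightarrow> real^'y) \<Rightarrow> nat \<Rightarrow> real^'x" where
  "kb_mean A C R1h R2h m0 P0 l y 0 = m0"
| "kb_mean A C R1h R2h m0 P0 l y (Suc k) =
     (let m = kb_mean A C R1h R2h m0 P0 l y k; P = kb_cov A C R1h R2h P0 l k
      in m + mesh l *\<^sub>R (A *v m)
           + (P ** transpose C ** matrix_inv (R2h ** R2h)) *v
               (grid_increment l y k - mesh l *\<^sub>R (C *v m)))"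

definition kb_law ::
  "real^'x^'x \<Rightarrow> real^'x^'y \<Rightarrow> real^'x^'x \<Rightarrow> real^'y^'y \<Rightarrow> real^'x \<Rightarrow> real^'x^'x \<Rightarrow> nat
   \<Rightarrow> (real \<Rightarrow> real^'y) \<Rightarrow> real \<Rightarrow> (real^'x) measure" where
  "kb_law A C R1h R2h m0 P0 l y t =
     gaussian_measure (kb_mean A C R1h R2h m0 P0 l y (grid_index l t))
                      (kb_cov A C R1h R2h P0 l (grid_index l t))"

end

theory Submission
  imports Defs
begin

text \<open>
  One step of the particle system acts on the ensemble as \<open>x\<^sub>i \<mapsto> F x\<^sub>i + R w\<^sub>i + G v\<^sub>i + c\<close>, where
  \<open>w\<^sub>i\<close>, \<open>v\<^sub>i\<close> are the two noise increments of particle \<open>i\<close>. The coefficients \<open>F\<close>, \<open>G\<close>, \<open>c\<close> are common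
  to all particles: they depend on the ensemble only through its sample covariance, and on the
  observations only through \<open>c\<close>. The sample mean commutes with such a map, and sample
  cross-covariances are bilinear and do not see the common shift \<open>c\<close>. So the new sample mean and sample
  covariance are continuous functions of the old ones, of the empirical moments of the noise, and
  of the sample cross-covariances between the states and the noise.

  This makes the limit \<open>N \<rightarrow> \<infinity>\<close> a pathwise induction over time (\<open>enkf_mean_tendsto_kb_mean\<close>), for a fixed
  observation path. Besides the convergence of the sample mean and the sample covariance to \<open>m\<^sub>k\<close> and
  \<open>P\<^sub>k\<close>, its invariant says that the sample cross-covariances between the states at step \<open>k\<close> and all
  noise increments from step \<open>k\<close> on vanish in the limit. In the limit the covariance of the affine
  image is \<open>F P F\<^sup>T + \<Delta> R R\<^sup>T + \<Delta> G G\<^sup>T\<close>, and a computation (\<open>kb_cov_Suc_eq\<close>) identifies this with the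
  discretized Riccati recursion.

  What the induction takes from probability is that, almost surely, the empirical means and
  cross-covariances of the initial states and noise increments converge to the true ones.
  The variables attached to different particles are independent, so this is a strong law of large
  numbers for the components and for the products of two components
  (\<open>AE_sample_mean_gaussian\<close>, \<open>AE_sample_cross_cov_gaussian\<close>). Gaussian variables have all moments,
  hence the elementary version of the strong law that uses bounded fourth moments suffices
  (\<open>strong_law_fourth_moment\<close>). The true covariances are read off from the Gaussian laws. Since
  \<open>gaussian_measure m P\<close> is built from a chosen \<open>L\<close> with \<open>L L\<^sup>T = P\<close>, its covariance is \<open>P\<close> only when such
  an \<open>L\<close> exists; for positive semidefinite \<open>P\<close> one is obtained by symmetric Gaussian elimination
  (\<open>sym_psd_factorization\<close>).
\<close>


section \<open>A strong law of large numbers from fourth moments\<close>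

lemma (in finite_measure) integrable_power_le:
  fixes f :: "'a \<Rightarrow> real"
  assumes [measurable]: "f \<in> borel_measurable M" and "even n" and "integrable M (\<lambda>x. f x ^ n)" and "k \<le> n"
  shows "integrable M (\<lambda>x. f x ^ k)"
proof (rule Bochner_Integration.integrable_bound)
  show "integrable M (\<lambda>x. 1 + f x ^ n)"
    using assms by simp
  have "\<bar>a\<bar> ^ k \<le> 1 + a ^ n" for a :: real
  proof (cases "\<bar>a\<bar> \<le> 1")
    case True
    then have "\<bar>a\<bar> ^ k \<le> 1" by (simp add: power_le_one)
    with \<open>even n\<close> show ?thesis by (meson add_increasing2 zero_le_even_power)
  next
    case False
    then have "\<bar>a\<bar> ^ k \<le> \<bar>a\<bar> ^ n" using \<open>k \<le> n\<close> by (intro power_increasing) auto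
    with \<open>even n\<close> show ?thesis by (simp add: power_even_abs)
  qed
  then show "AE x in M. norm (f x ^ k) \<le> norm (1 + f x ^ n)"
    by (auto simp: power_abs intro: order_trans[OF _ abs_ge_self])
qed simp

lemma power4_add_le: "(a + b) ^ 4 \<le> 8 * (a ^ 4 + b ^ 4)" for a b :: real
proof -
  have 1: "(x + y)\<^sup>2 \<le> 2 * (x\<^sup>2 + y\<^sup>2)" for x y :: real
    using sum_squares_bound[of x y] by (simp add: power2_sum)
  have "((a + b)\<^sup>2)\<^sup>2 \<le> (2 * (a\<^sup>2 + b\<^sup>2))\<^sup>2"
    by (rule power_mono[OF 1]) simp
  also have "\<dots> \<le> 4 * (2 * ((a\<^sup>2)\<^sup>2 + (b\<^sup>2)\<^sup>2))"
    using 1[of "a\<^sup>2" "b\<^sup>2"] by (simp only: power_mult_distrib) simp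
  finally show ?thesis by simp
qed

lemma integrable_power4_add:
  fixes f g :: "'a \<Rightarrow> real"
  assumes [measurable]: "f \<in> borel_measurable M" "g \<in> borel_measurable M"
    and "integrable M (\<lambda>x. f x ^ 4)" "integrable M (\<lambda>x. g x ^ 4)"
  shows "integrable M (\<lambda>x. (f x + g x) ^ 4)"
proof (rule Bochner_Integration.integrable_bound)
  show "integrable M (\<lambda>x. 8 * (f x ^ 4 + g x ^ 4))" using assms by simp
  show "AE x in M. norm ((f x + g x) ^ 4) \<le> norm (8 * (f x ^ 4 + g x ^ 4))"
    using power4_add_le by (auto intro: order_trans[OF _ abs_ge_self])
qed simp

text \<open>All mixed terms with a factor \<open>X\<close> or \<open>S\<close> to the first power drop out of the
  binomial expansions, because both variables are centred.\<close>

lemma (in prob_space) moments_indep_sum: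
  fixes X S :: "'a \<Rightarrow> real"
  assumes indep: "indep_var borel X borel S"
    and X4: "integrable M (\<lambda>\<omega>. X \<omega> ^ 4)" and S4: "integrable M (\<lambda>\<omega>. S \<omega> ^ 4)"
    and X1: "expectation X = 0" and S1: "expectation S = 0"
  shows "expectation (\<lambda>\<omega>. (X \<omega> + S \<omega>) ^ 2) = expectation (\<lambda>\<omega>. X \<omega> ^ 2) + expectation (\<lambda>\<omega>. S \<omega> ^ 2)"
    and "expectation (\<lambda>\<omega>. (X \<omega> + S \<omega>) ^ 4) = expectation (\<lambda>\<omega>. X \<omega> ^ 4)
           + 6 * expectation (\<lambda>\<omega>. X \<omega> ^ 2) * expectation (\<lambda>\<omega>. S \<omega> ^ 2) + expectation (\<lambda>\<omega>. S \<omega> ^ 4)"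
proof -
  have [measurable]: "X \<in> borel_measurable M" "S \<in> borel_measurable M"
    using indep_var_rv1[OF indep] indep_var_rv2[OF indep] by auto
  have Xk: "integrable M (\<lambda>\<omega>. X \<omega> ^ k)" and Sk: "integrable M (\<lambda>\<omega>. S \<omega> ^ k)" if "k \<le> 4" for k
    using integrable_power_le[OF _ _ X4 that] integrable_power_le[OF _ _ S4 that] by auto
  have "indep_var borel (\<lambda>\<omega>. X \<omega> ^ i) borel (\<lambda>\<omega>. S \<omega> ^ j)" for i j
    using indep_var_compose[OF indep, of "\<lambda>x. x ^ i" borel "\<lambda>x. x ^ j" borel] by (simp add: comp_def)
  then have int: "integrable M (\<lambda>\<omega>. X \<omega> ^ i * S \<omega> ^ j)"
    and E: "expectation (\<lambda>\<omega>. X \<omega> ^ i * S \<omega> ^ j) = expectation (\<lambda>\<omega>. X \<omega> ^ i) * expectation (\<lambda>\<omega>. S \<omega> ^ j)"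
    if "i \<le> 4" "j \<le> 4" for i j
    using that by (auto intro!: indep_var_integrable indep_var_lebesgue_integral Xk Sk)
  have e2: "(a + b) ^ 2 = a ^ 2 + 2 * (a ^ 1 * b ^ 1) + b ^ 2" for a b :: real
    by (simp add: power2_eq_square algebra_simps)
  have e4: "(a + b) ^ 4 = a ^ 4 + 4 * (a ^ 3 * b ^ 1) + 6 * (a ^ 2 * b ^ 2) + 4 * (a ^ 1 * b ^ 3) + b ^ 4" for a b :: real
    by (simp add: eval_nat_numeral algebra_simps)
  show "expectation (\<lambda>\<omega>. (X \<omega> + S \<omega>) ^ 2) = expectation (\<lambda>\<omega>. X \<omega> ^ 2) + expectation (\<lambda>\<omega>. S \<omega> ^ 2)"
    unfolding e2 using int[of 1 1] E[of 1 1] Xk[of 2] Sk[of 2] X1 S1 by simp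
  show "expectation (\<lambda>\<omega>. (X \<omega> + S \<omega>) ^ 4) = expectation (\<lambda>\<omega>. X \<omega> ^ 4)
           + 6 * expectation (\<lambda>\<omega>. X \<omega> ^ 2) * expectation (\<lambda>\<omega>. S \<omega> ^ 2) + expectation (\<lambda>\<omega>. S \<omega> ^ 4)"
    unfolding e4
    using int[of 3 1] E[of 3 1] int[of 2 2] E[of 2 2] int[of 1 3] E[of 1 3] Xk[of 4] Sk[of 4] X1 S1 by simp
qed

text \<open>Only squared growth in \<open>N\<close> matters here: it makes the fourth moments of the averages summable.
  The induction adds one summand at a time and carries the second moment along, which grows
  linearly in \<open>N\<close>.\<close>

lemma (in prob_space) fourth_moment_sum_le:
  fixes X :: "nat \<Rightarrow> 'a \<Rightarrow> real"
  assumes indep: "indep_vars (\<lambda>_. borel) X {1..}"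
    and X4: "\<And>i. i \<ge> 1 \<Longrightarrow> integrable M (\<lambda>\<omega>. X i \<omega> ^ 4)"
    and X1: "\<And>i. i \<ge> 1 \<Longrightarrow> expectation (X i) = 0"
    and B: "\<And>i. i \<ge> 1 \<Longrightarrow> expectation (\<lambda>\<omega>. X i \<omega> ^ 4) \<le> B"
  shows "integrable M (\<lambda>\<omega>. (\<Sum>i=1..N. X i \<omega>) ^ 4)"
    and "expectation (\<lambda>\<omega>. (\<Sum>i=1..N. X i \<omega>) ^ 4) \<le> 6 * (1 + B)\<^sup>2 * (real N)\<^sup>2"
proof -
  have mX[measurable]: "X i \<in> borel_measurable M" if "i \<ge> 1" for i
    using indep that by (auto simp: indep_vars_def)
  have B0: "B \<ge> 0"
    by (rule order_trans[OF integral_nonneg_AE B[of 1]]) simp_all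
  have X2: "expectation (\<lambda>\<omega>. X i \<omega> ^ 2) \<le> 1 + B" if "i \<ge> 1" for i
  proof -
    have sq: "a ^ 2 \<le> 1 + a ^ 4" for a :: real
    proof -
      have "2 * a\<^sup>2 \<le> 1 + a ^ 4" using sum_squares_bound[of 1 "a\<^sup>2"] by simp
      then show ?thesis using zero_le_power2[of a] by linarith
    qed
    have "expectation (\<lambda>\<omega>. X i \<omega> ^ 2) \<le> expectation (\<lambda>\<omega>. 1 + X i \<omega> ^ 4)"
      using that X4[OF that] integrable_power_le[OF mX[OF that] _ X4[OF that], of 2]
      by (intro integral_mono sq) auto
    also have "\<dots> \<le> 1 + B" using X4[OF that] B[OF that] by (simp add: prob_space)
    finally show ?thesis .
  qed
  let ?S = "\<lambda>N \<omega>. \<Sum>i=1..N. X i \<omega>"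
  have "integrable M (\<lambda>\<omega>. ?S N \<omega> ^ 4) \<and> expectation (?S N) = 0
      \<and> expectation (\<lambda>\<omega>. ?S N \<omega> ^ 2) \<le> real N * (1 + B)
      \<and> expectation (\<lambda>\<omega>. ?S N \<omega> ^ 4) \<le> 6 * (1 + B)\<^sup>2 * (real N)\<^sup>2"
  proof (induction N)
    case 0
    show ?case by simp
  next
    case (Suc N)
    then have S4: "integrable M (\<lambda>\<omega>. ?S N \<omega> ^ 4)" and S1: "expectation (?S N) = 0"
      and S2: "expectation (\<lambda>\<omega>. ?S N \<omega> ^ 2) \<le> real N * (1 + B)"
      and S4': "expectation (\<lambda>\<omega>. ?S N \<omega> ^ 4) \<le> 6 * (1 + B)\<^sup>2 * (real N)\<^sup>2" by blast+
    let ?Y = "X (Suc N)"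
    have [measurable]: "?S N \<in> borel_measurable M" by (auto intro!: borel_measurable_sum mX)
    have eq: "?S (Suc N) \<omega> = ?Y \<omega> + ?S N \<omega>" for \<omega> by simp
    have ind: "indep_var borel ?Y borel (?S N)"
      by (rule indep_vars_sum) (auto intro!: indep_vars_subset[OF indep])
    have N1: "1 \<le> Suc N" by simp
    note m = moments_indep_sum[OF ind X4[OF N1] S4 X1[OF N1] S1]
    have Y0: "0 \<le> expectation (\<lambda>\<omega>. ?Y \<omega> ^ 2)" by (intro integral_nonneg_AE) auto
    have "expectation (\<lambda>\<omega>. ?Y \<omega> ^ 2) * expectation (\<lambda>\<omega>. ?S N \<omega> ^ 2) \<le> (1 + B) * (real N * (1 + B))"
      using X2[of "Suc N"] S2 B0 by (intro mult_mono integral_nonneg_AE) auto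
    then have "expectation (\<lambda>\<omega>. ?S (Suc N) \<omega> ^ 4) \<le> B + 6 * ((1 + B) * (real N * (1 + B))) + 6 * (1 + B)\<^sup>2 * (real N)\<^sup>2"
      unfolding eq m using S4' B[of "Suc N"] by simp
    also have "\<dots> \<le> 6 * (1 + B)\<^sup>2 * (real (Suc N))\<^sup>2"
    proof -
      \<comment> \<open>The constant \<open>6 (1 + B)\<^sup>2\<close> works since \<open>(N + 1)\<^sup>2 - N\<^sup>2 = 2 N + 1\<close> leaves room for both new terms.\<close>
      have "B \<le> (1 + B)\<^sup>2" using B0 by (simp add: power2_eq_square algebra_simps)
      moreover have "0 \<le> (1+B)\<^sup>2 * real N" by simp
      moreover have "0 \<le> B * B" by simp
      moreover note B0
      ultimately show ?thesis by (simp add: power2_eq_square algebra_simps)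
    qed
    finally have 4: "expectation (\<lambda>\<omega>. ?S (Suc N) \<omega> ^ 4) \<le> 6 * (1 + B)\<^sup>2 * (real (Suc N))\<^sup>2" .
    have "integrable M (\<lambda>\<omega>. ?S (Suc N) \<omega> ^ 4)"
      unfolding eq by (intro integrable_power4_add X4 S4) auto
    moreover have "expectation (?S (Suc N)) = 0"
      unfolding eq using X1[of "Suc N"] S1 integrable_power_le[OF _ _ X4[of "Suc N"], of 1] integrable_power_le[OF _ _ S4, of 1]
      by simp
    moreover have "expectation (\<lambda>\<omega>. ?S (Suc N) \<omega> ^ 2) \<le> real (Suc N) * (1 + B)"
      unfolding eq m using X2[of "Suc N"] S2 by (simp add: algebra_simps)
    ultimately show ?case using 4 by blast
  qed
  then show "integrable M (\<lambda>\<omega>. (\<Sum>i=1..N. X i \<omega>) ^ 4)"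
    and "expectation (\<lambda>\<omega>. (\<Sum>i=1..N. X i \<omega>) ^ 4) \<le> 6 * (1 + B)\<^sup>2 * (real N)\<^sup>2" by blast+
qed

text \<open>The sum of all \<open>Y n\<close> has finite expectation, so it is almost surely finite, and the terms of
  a convergent series tend to zero.\<close>

lemma (in prob_space) AE_tendsto_0_if_summable_expectation:
  fixes Y :: "nat \<Rightarrow> 'a \<Rightarrow> real"
  assumes Y: "\<And>n. integrable M (Y n)" and nonneg: "\<And>n \<omega>. 0 \<le> Y n \<omega>"
    and sum: "summable (\<lambda>n. expectation (Y n))"
  shows "AE \<omega> in M. (\<lambda>n. Y n \<omega>) \<longlonglongrightarrow> 0"
proof -
  have [measurable]: "Y n \<in> borel_measurable M" for n using Y by auto
  have "(\<integral>\<^sup>+\<omega>. (\<Sum>n. ennreal (Y n \<omega>)) \<partial>M) = (\<Sum>n. ennreal (expectation (Y n)))"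
    using Y nonneg by (subst nn_integral_suminf) (auto intro!: suminf_cong nn_integral_eq_integral)
  also have "\<dots> = ennreal (\<Sum>n. expectation (Y n))"
    using sum nonneg by (intro suminf_ennreal2 integral_nonneg_AE) auto
  finally have "(\<integral>\<^sup>+\<omega>. (\<Sum>n. ennreal (Y n \<omega>)) \<partial>M) \<noteq> \<infinity>" by simp
  then have "AE \<omega> in M. (\<Sum>n. ennreal (Y n \<omega>)) \<noteq> \<infinity>"
    by (intro nn_integral_PInf_AE) auto
  then show ?thesis
  proof (eventually_elim)
    fix \<omega> assume "(\<Sum>n. ennreal (Y n \<omega>)) \<noteq> \<infinity>"
    then have "summable (\<lambda>n. Y n \<omega>)"
      using nonneg by (intro summable_suminf_not_top) auto
    then show "(\<lambda>n. Y n \<omega>) \<longlonglongrightarrow> 0" by (rule summable_LIMSEQ_zero)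
  qed
qed

text \<open>The fourth moment of the centred average is \<open>O(1/N\<^sup>2)\<close>, which is summable, so its
  fourth powers tend to zero almost surely.\<close>

lemma (in prob_space) strong_law_fourth_moment:
  fixes X :: "nat \<Rightarrow> 'a \<Rightarrow> real"
  assumes indep: "indep_vars (\<lambda>_. borel) X {1..}"
    and X4: "\<And>i. i \<ge> 1 \<Longrightarrow> integrable M (\<lambda>\<omega>. X i \<omega> ^ 4)"
    and mean: "\<And>i. i \<ge> 1 \<Longrightarrow> expectation (X i) = \<mu>"
    and B: "\<And>i. i \<ge> 1 \<Longrightarrow> expectation (\<lambda>\<omega>. X i \<omega> ^ 4) \<le> B"
  shows "AE \<omega> in M. (\<lambda>N. (\<Sum>i=1..N. X i \<omega>) / real N) \<longlonglongrightarrow> \<mu>"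
proof -
  have mX[measurable]: "X i \<in> borel_measurable M" if "i \<ge> 1" for i
    using indep that by (auto simp: indep_vars_def)
  let ?X = "\<lambda>i \<omega>. X i \<omega> + (- \<mu>)"
  let ?S = "\<lambda>N \<omega>. \<Sum>i=1..N. ?X i \<omega>"
  have indep': "indep_vars (\<lambda>_. borel) ?X {1..}"
    using indep_vars_compose2[OF indep, of "\<lambda>_ x. x + (- \<mu>)" "\<lambda>_. borel"] by simp
  have X4': "integrable M (\<lambda>\<omega>. ?X i \<omega> ^ 4)" if "i \<ge> 1" for i
    using X4[OF that] that by (intro integrable_power4_add) auto
  have X1': "expectation (?X i) = 0" if "i \<ge> 1" for i
    using integrable_power_le[OF mX[OF that] _ X4[OF that], of 1] mean[OF that] by (simp add: prob_space)
  have B': "expectation (\<lambda>\<omega>. ?X i \<omega> ^ 4) \<le> 8 * (B + \<mu> ^ 4)" if "i \<ge> 1" for i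
  proof -
    have "expectation (\<lambda>\<omega>. ?X i \<omega> ^ 4) \<le> expectation (\<lambda>\<omega>. 8 * (X i \<omega> ^ 4 + (- \<mu>) ^ 4))"
      using X4'[OF that] X4[OF that] by (intro integral_mono power4_add_le) auto
    also have "\<dots> \<le> 8 * (B + \<mu> ^ 4)" using X4[OF that] B[OF that] by (simp add: prob_space)
    finally show ?thesis .
  qed
  let ?K = "6 * (1 + 8 * (B + \<mu> ^ 4))\<^sup>2"
  note S = fourth_moment_sum_le[OF indep' X4' X1' B']
  have "AE \<omega> in M. (\<lambda>N. (?S N \<omega> / real N) ^ 4) \<longlonglongrightarrow> 0"
  proof (rule AE_tendsto_0_if_summable_expectation)
    show "integrable M (\<lambda>\<omega>. (?S N \<omega> / real N) ^ 4)" for N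
      using S(1)[of N] by (simp add: power_divide)
    show "0 \<le> (?S N \<omega> / real N) ^ 4" for N \<omega> by simp
    show "summable (\<lambda>N. expectation (\<lambda>\<omega>. (?S N \<omega> / real N) ^ 4))"
    proof (rule summable_comparison_test')
      show "summable (\<lambda>N. ?K * inverse (real N ^ 2))"
        by (intro summable_mult inverse_power_summable) simp
      fix N :: nat
      have "expectation (\<lambda>\<omega>. (?S N \<omega> / real N) ^ 4) = expectation (\<lambda>\<omega>. ?S N \<omega> ^ 4) / real N ^ 4"
        by (simp add: power_divide)
      also have "\<dots> \<le> (?K * (real N)\<^sup>2) / real N ^ 4"
        by (intro divide_right_mono S(2)) auto
      also have "\<dots> = ?K * inverse (real N ^ 2)"
        by (cases "N = 0") (simp_all add: field_simps eval_nat_numeral)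
      finally show "norm (expectation (\<lambda>\<omega>. (?S N \<omega> / real N) ^ 4)) \<le> ?K * inverse (real N ^ 2)"
        by (subst real_norm_def, subst abs_of_nonneg) (auto intro!: integral_nonneg_AE)
    qed
  qed
  then show ?thesis
  proof eventually_elim
    fix \<omega> assume "(\<lambda>N. (?S N \<omega> / real N) ^ 4) \<longlonglongrightarrow> 0"
    then have "(\<lambda>N. ?S N \<omega> / real N) \<longlonglongrightarrow> 0" by (simp add: power_tendsto_0_iff)
    then have "(\<lambda>N. ?S N \<omega> / real N + \<mu>) \<longlonglongrightarrow> 0 + \<mu>" by (intro tendsto_intros)
    moreover have "?S N \<omega> / real N + \<mu> = (\<Sum>i=1..N. X i \<omega>) / real N" if "N > 0" for N
      using that by (simp add: sum_subtractf sum.distrib field_simps)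
    ultimately show "(\<lambda>N. (\<Sum>i=1..N. X i \<omega>) / real N) \<longlonglongrightarrow> \<mu>"
      by (subst tendsto_cong[OF eventually_mono[OF eventually_gt_at_top[of 0]], symmetric]) simp_all
  qed
qed


section \<open>Moments of Gaussian measures\<close>

text \<open>This class of random variables is closed under sums and products, so it contains every polynomial
  in Gaussian components.\<close>

definition has_all_moments :: "'a measure \<Rightarrow> ('a \<Rightarrow> real) \<Rightarrow> bool" where
  "has_all_moments M f \<longleftrightarrow> f \<in> borel_measurable M \<and> (\<forall>k. integrable M (\<lambda>x. f x ^ k))"

lemma has_all_momentsD:
  assumes "has_all_moments M f"
  shows "f \<in> borel_measurable M" "integrable M (\<lambda>x. f x ^ k)" "integrable M f"
  using assms[unfolded has_all_moments_def] by (auto dest: spec[of _ 1])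

lemma has_all_moments_const: "finite_measure M \<Longrightarrow> has_all_moments M (\<lambda>x. c)"
  by (simp add: has_all_moments_def finite_measure.integrable_const)

lemma abs_mult_le_sum_squares: "\<bar>a * b\<bar> \<le> a\<^sup>2 + b\<^sup>2" for a b :: real
  using sum_squares_bound[of "\<bar>a\<bar>" "\<bar>b\<bar>"] abs_ge_zero[of "a * b"]
  unfolding abs_mult power2_abs by linarith

lemma integrable_power_mult_power:
  assumes "has_all_moments M f" "has_all_moments M g"
  shows "integrable M (\<lambda>x. f x ^ i * g x ^ j)"
proof (rule Bochner_Integration.integrable_bound)
  note [measurable] = assms[THEN has_all_momentsD(1)]
  show "integrable M (\<lambda>x. f x ^ (2 * i) + g x ^ (2 * j))"
    using assms by (intro Bochner_Integration.integrable_add has_all_momentsD)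
  from abs_mult_le_sum_squares[of "f x ^ i" "g x ^ j" for x]
  show "AE x in M. norm (f x ^ i * g x ^ j) \<le> norm (f x ^ (2 * i) + g x ^ (2 * j))"
    by (auto simp: power_mult mult.commute[of 2] intro: order_trans[OF _ abs_ge_self])
  show "(\<lambda>x. f x ^ i * g x ^ j) \<in> borel_measurable M" by measurable
qed

lemma has_all_moments_add:
  assumes "has_all_moments M f" "has_all_moments M g"
  shows "has_all_moments M (\<lambda>x. f x + g x)"
  using assms unfolding has_all_moments_def binomial_ring
  by (auto intro!: Bochner_Integration.integrable_sum integrable_mult_right
      integrable_power_mult_power[OF assms] simp: mult.assoc)

lemma has_all_moments_mult:
  assumes "has_all_moments M f" "has_all_moments M g"
  shows "has_all_moments M (\<lambda>x. f x * g x)"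
  using assms integrable_power_mult_power[OF assms] unfolding has_all_moments_def
  by (auto simp: power_mult_distrib)

lemma has_all_moments_sum:
  assumes "finite_measure M" "finite I" "\<And>i. i \<in> I \<Longrightarrow> has_all_moments M (f i)"
  shows "has_all_moments M (\<lambda>x. \<Sum>i\<in>I. f i x)"
  using assms(2,3) by (induction I rule: finite_induct)
    (auto intro: has_all_moments_add has_all_moments_const[OF assms(1)])

lemma has_all_moments_distr:
  assumes "T \<in> measurable M N" "f \<in> borel_measurable N"
  shows "has_all_moments (distr M N T) f \<longleftrightarrow> has_all_moments M (\<lambda>x. f (T x))"
  unfolding has_all_moments_def using assms
  by (auto simp: integrable_distr_eq)

abbreviation std_normal :: "real measure" where
  "std_normal \<equiv> density lborel (\<lambda>x. ennreal (std_normal_density x))"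

lemma std_normal_moments:
  "prob_space std_normal"
  "integrable std_normal (\<lambda>x. x ^ k)"
  "(\<integral>x. x \<partial>std_normal) = 0"
  "(\<integral>x. x\<^sup>2 \<partial>std_normal) = 1"
proof -
  show "prob_space std_normal" by (rule prob_space_normal_density) simp
  show "integrable std_normal (\<lambda>x. x ^ k)"
    using integrable_std_normal_moment[of k] by (simp add: integrable_density)
  show "(\<integral>x. x \<partial>std_normal) = 0"
    using integral_std_normal_moment_odd[of 0] by (simp add: integral_density)
  show "(\<integral>x. x\<^sup>2 \<partial>std_normal) = 1"
    using integral_std_normal_moment_even[of 1] by (simp add: integral_density)
qed

lemma vec_lambda_measurable_PiM:
  "(\<lambda>z. \<chi> i. z i) \<in> measurable (\<Pi>\<^sub>M i\<in>(UNIV :: 'n::finite set). std_normal) (borel :: (real^'n) measure)"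
proof (rule borel_measurable_euclidean_space[THEN iffD2], rule ballI)
  fix b :: "real^'n" assume "b \<in> Basis"
  then obtain i where "b = axis i 1" by (auto simp: Basis_vec_def)
  then show "(\<lambda>z. (\<chi> i. z i) \<bullet> b) \<in> borel_measurable (\<Pi>\<^sub>M i\<in>(UNIV :: 'n set). std_normal)"
    by (simp add: inner_axis)
qed

lemma std_gaussian_moments:
  fixes i j :: "'n::finite"
  shows "prob_space (std_gaussian :: (real^'n) measure)"
    and "sets (std_gaussian :: (real^'n) measure) = sets borel"
    and "has_all_moments std_gaussian (\<lambda>z. z $ i)"
    and "(\<integral>z. z $ i \<partial>std_gaussian) = 0"
    and "(\<integral>z. z $ i * z $ j \<partial>std_gaussian) = (if i = j then 1 else 0)"
proof -
  interpret N: prob_space std_normal by (rule std_normal_moments)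
  interpret product_prob_space "\<lambda>_::'n. std_normal" UNIV ..
  let ?P = "\<Pi>\<^sub>M i\<in>(UNIV :: 'n set). std_normal"
  note [measurable] = vec_lambda_measurable_PiM
  show "prob_space (std_gaussian :: (real^'n) measure)"
    unfolding std_gaussian_def by (rule P.prob_space_distr) measurable
  show "sets (std_gaussian :: (real^'n) measure) = sets borel"
    unfolding std_gaussian_def by simp
  have mono: "integrable ?P (\<lambda>z. z i ^ p * z j ^ q)"
    "(\<integral>z. z i ^ p * z j ^ q \<partial>?P) =
      (\<Prod>k\<in>UNIV. \<integral>x. x ^ ((if k = i then p else 0) + (if k = j then q else 0)) \<partial>std_normal)"
    for p q and i j :: 'n
  proof -
    \<comment> \<open>Written as a product over all coordinates, a monomial integrates factor by factor; the exponents at \<open>i = j\<close> add up.\<close>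
    have eq: "z i ^ p * z j ^ q = (\<Prod>k\<in>UNIV. z k ^ ((if k = i then p else 0) + (if k = j then q else 0)))"
      for z :: "'n \<Rightarrow> real"
      by (simp add: power_add prod.distrib if_distrib[of "\<lambda>e. _ ^ e"] prod.delta cong: if_cong)
    show "integrable ?P (\<lambda>z. z i ^ p * z j ^ q)"
      unfolding eq by (intro product_integrable_prod std_normal_moments) simp
    show "(\<integral>z. z i ^ p * z j ^ q \<partial>?P) =
      (\<Prod>k\<in>UNIV. \<integral>x. x ^ ((if k = i then p else 0) + (if k = j then q else 0)) \<partial>std_normal)"
      unfolding eq by (intro product_integral_prod std_normal_moments) simp
  qed
  have ev: "has_all_moments (std_gaussian :: (real^'n) measure) f \<longleftrightarrow> has_all_moments ?P (\<lambda>z. f (\<chi> i. z i))"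
    "(\<integral>z. f z \<partial>(std_gaussian :: (real^'n) measure)) = (\<integral>z. f (\<chi> i. z i) \<partial>?P)"
    if "f \<in> borel_measurable borel" for f
    unfolding std_gaussian_def using that by (auto intro!: has_all_moments_distr integral_distr)
  show "has_all_moments (std_gaussian :: (real^'n) measure) (\<lambda>z. z $ i)"
    using mono(1)[of i _ i 0] by (subst ev) (auto simp: has_all_moments_def)
  show "(\<integral>z. z $ i \<partial>(std_gaussian :: (real^'n) measure)) = 0"
    using mono(2)[of i 1 i 0] std_normal_moments(3)
    by (subst ev) (auto intro!: prod_zero bexI[of _ i])
  show "(\<integral>z. z $ i * z $ j \<partial>(std_gaussian :: (real^'n) measure)) = (if i = j then 1 else 0)"
  proof (cases "i = j")
    case True
    then show ?thesis
      using mono(2)[of i 1 i 1] std_normal_moments(4)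
      by (subst ev) (auto simp: N.prob_space[simplified] power2_eq_square intro!: prod.neutral)
  next
    case False
    then show ?thesis
      using mono(2)[of i 1 j 1] std_normal_moments(3)
      by (subst ev) (auto intro!: prod_zero bexI[of _ i])
  qed
qed

text \<open>Every component is an affine function of independent standard normal variables. For the matrix \<open>L\<close>
  chosen in \<open>gaussian_measure\<close> the covariance is \<open>L L\<^sup>T\<close>; the existence of a factorization of \<open>P\<close>
  ensures that this is \<open>P\<close>.\<close>

lemma gaussian_measure_moments:
  fixes m :: "real^'n" and P :: "real^'n^'n"
  shows "prob_space (gaussian_measure m P)"
    and "sets (gaussian_measure m P) = sets borel"
    and "has_all_moments (gaussian_measure m P) (\<lambda>x. x $ a)"
    and "(\<integral>x. x $ a \<partial>gaussian_measure m P) = m $ a"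
    and "(\<integral>x. x \<partial>gaussian_measure m P) = m"
    and "\<exists>L :: real^'n^'n. L ** transpose L = P \<Longrightarrow>
      (\<integral>x. x $ a * x $ b \<partial>gaussian_measure m P) = P $ a $ b + m $ a * m $ b"
proof -
  define L :: "real^'n^'n" where "L = (SOME L. L ** transpose L = P)"
  let ?G = "std_gaussian :: (real^'n) measure"
  let ?T = "\<lambda>z. m + L *v z"
  have G: "gaussian_measure m P = distr ?G borel ?T"
    unfolding gaussian_measure_def L_def Let_def ..
  interpret prob_space ?G by (rule std_gaussian_moments)
  note sets_G[measurable_cong] = std_gaussian_moments(2)
  have T[measurable]: "?T \<in> measurable ?G borel"
    by (subst measurable_cong_sets[OF std_gaussian_moments(2) refl],
        rule borel_measurable_continuous_onI) (intro continuous_intros linear_continuous_on, simp)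
  have z: "has_all_moments ?G (\<lambda>z. z $ a)" for a by (rule std_gaussian_moments)
  have Ta: "?T z $ a = m $ a + (\<Sum>b\<in>UNIV. L $ a $ b * z $ b)" for z a
    by (simp add: matrix_vector_mult_def)
  have fin: "finite_measure ?G" by (rule finite_measure_axioms)
  have lin: "has_all_moments ?G (\<lambda>z. \<Sum>b\<in>UNIV. L $ a $ b * z $ b)" for a
    by (intro has_all_moments_sum has_all_moments_mult has_all_moments_const fin z) simp
  have int[simp]: "integrable ?G (\<lambda>z. z $ a)" "integrable ?G (\<lambda>z. z $ a * z $ b)" for a b
    using has_all_momentsD(3) has_all_moments_mult z by blast+
  have E1: "(\<integral>z. (\<Sum>b\<in>UNIV. L $ a $ b * z $ b) \<partial>?G) = 0" for a
    by (simp add: std_gaussian_moments)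
  have Tm: "has_all_moments ?G (\<lambda>z. ?T z $ a)" for a
    unfolding Ta by (intro has_all_moments_add has_all_moments_const fin lin)
  show "prob_space (gaussian_measure m P)"
    unfolding G by (rule prob_space_distr) (rule T)
  show "sets (gaussian_measure m P) = sets borel" unfolding G by simp
  show "has_all_moments (gaussian_measure m P) (\<lambda>x. x $ a)" for a
    unfolding G by (subst has_all_moments_distr[OF T]) (auto intro: Tm[simplified])
  then have inta: "integrable (gaussian_measure m P) (\<lambda>x. x $ a)" for a
    by (rule has_all_momentsD)
  show mean: "(\<integral>x. x $ a \<partial>gaussian_measure m P) = m $ a" for a
    unfolding G using has_all_momentsD(3)[OF lin] E1 prob_space
    by (subst integral_distr[OF T]) (simp_all only: Ta, simp_all)
  have "integrable (gaussian_measure m P) (\<lambda>x. x)"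
  proof -
    have "integrable (gaussian_measure m P) (\<lambda>x. \<Sum>a\<in>UNIV. x $ a *\<^sub>R axis a 1 :: real^'n)"
      by (intro Bochner_Integration.integrable_sum integrable_scaleR_left inta)
    moreover have "(\<Sum>a\<in>UNIV. x $ a *\<^sub>R axis a 1) = x" for x :: "real^'n"
      using basis_expansion[of x] by (simp add: scalar_mult_eq_scaleR)
    ultimately show ?thesis by simp
  qed
  then have "(\<integral>x. x \<partial>gaussian_measure m P) $ a = m $ a" for a
    using integral_bounded_linear[OF bounded_linear_vec_nth, of "gaussian_measure m P" "\<lambda>x. x" a] mean[of a]
    by simp
  then show "(\<integral>x. x \<partial>gaussian_measure m P) = m" by (simp add: vec_eq_iff)
  show "(\<integral>x. x $ a * x $ b \<partial>gaussian_measure m P) = P $ a $ b + m $ a * m $ b"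
    if "\<exists>L :: real^'n^'n. L ** transpose L = P"
  proof -
    have L: "L ** transpose L = P" unfolding L_def using that by (rule someI_ex)
    have intl: "integrable ?G (\<lambda>z. (\<Sum>c\<in>UNIV. L $ a $ c * z $ c) * (\<Sum>d\<in>UNIV. L $ b $ d * z $ d))"
      by (rule has_all_momentsD(3)[OF has_all_moments_mult[OF lin lin]])
    have "(\<integral>x. x $ a * x $ b \<partial>gaussian_measure m P)
      = (\<integral>z. m $ a * m $ b + m $ a * (\<Sum>d\<in>UNIV. L $ b $ d * z $ d) + m $ b * (\<Sum>c\<in>UNIV. L $ a $ c * z $ c)
            + (\<Sum>c\<in>UNIV. L $ a $ c * z $ c) * (\<Sum>d\<in>UNIV. L $ b $ d * z $ d) \<partial>?G)"
      unfolding G by (subst integral_distr[OF T], simp, simp only: Ta, intro Bochner_Integration.integral_cong)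
        (simp_all add: algebra_simps)
    also have "\<dots> = m $ a * m $ b + (\<integral>z. (\<Sum>c\<in>UNIV. L $ a $ c * z $ c) * (\<Sum>d\<in>UNIV. L $ b $ d * z $ d) \<partial>?G)"
      using intl has_all_momentsD(3)[OF lin] E1 prob_space by simp
    also have "(\<integral>z. (\<Sum>c\<in>UNIV. L $ a $ c * z $ c) * (\<Sum>d\<in>UNIV. L $ b $ d * z $ d) \<partial>?G)
      = (\<Sum>c\<in>UNIV. \<Sum>d\<in>UNIV. L $ a $ c * L $ b $ d * (\<integral>z. z $ c * z $ d \<partial>?G))"
      by (simp add: sum_product mult.assoc mult.left_commute[of "_ $ _" "L $ b $ _"])
    also have "\<dots> = (\<Sum>c\<in>UNIV. L $ a $ c * L $ b $ c)"
      by (simp add: std_gaussian_moments if_distrib[of "\<lambda>e. _ * e"] cong: if_cong)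
    also have "\<dots> = P $ a $ b"
      unfolding L[symmetric] by (simp add: matrix_matrix_mult_def transpose_def)
    finally show ?thesis by simp
  qed
qed

section \<open>Matrix calculus\<close>

lemma outer_product_add_left: "outer_product (u + u') v = outer_product u v + outer_product u' v"
  and outer_product_zero_left: "outer_product 0 v = 0"
  and outer_product_mult_left: "outer_product (F *v u) v = F ** outer_product u v"
  by (simp_all add: outer_product_def vec_eq_iff matrix_matrix_mult_def matrix_vector_mult_def
      algebra_simps sum_distrib_left)

lemma outer_product_transpose: "outer_product v u = transpose (outer_product u v)"
  by (simp add: outer_product_def transpose_def vec_eq_iff mult.commute)

lemma matrix_mult_distrib:
  fixes A A' :: "real^'n^'m" and B B' :: "real^'p^'n"
  shows "(A + A') ** B = A ** B + A' ** B" "A ** (B + B') = A ** B + A ** B'"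
    and "(A - A') ** B = A ** B - A' ** B" "A ** (B - B') = A ** B - A ** B'"
    and "(c *\<^sub>R A) ** B = c *\<^sub>R (A ** B)" "A ** (c *\<^sub>R B) = c *\<^sub>R (A ** B)"
    and "(- A) ** B = - (A ** B)" "A ** (- B) = - (A ** B)"
  by (simp_all add: matrix_matrix_mult_def vec_eq_iff sum.distrib sum_subtractf sum_negf
      sum_distrib_left algebra_simps)

lemma matrix_vector_mult_scaleR_left: "(c *\<^sub>R A) *v x = c *\<^sub>R (A *v x)"
  and matrix_vector_mult_minus_left: "(- A) *v x = - (A *v x)" for A :: "real^'n^'m"
  by (simp_all add: matrix_vector_mult_def vec_eq_iff sum_distrib_left sum_negf mult.assoc)

lemma transpose_linear:
  "transpose (A + B) = transpose A + transpose B"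
  "transpose (A - B) = transpose A - transpose B"
  "transpose (c *\<^sub>R A) = c *\<^sub>R transpose A"
  "transpose (- A) = - transpose A"
  for A B :: "real^'n^'m"
  by (simp_all add: transpose_def vec_eq_iff)

lemma sum_matrix_mult_left: "(\<Sum>i\<in>I. F ** B i) = F ** (\<Sum>i\<in>I. B i)" for F :: "real^'n^'m"
  by (induction I rule: infinite_finite_induct) (simp_all add: matrix_add_ldistrib)

lemma sum_matrix_vector_mult: "(\<Sum>i\<in>I. F *v x i) = F *v (\<Sum>i\<in>I. x i)" for F :: "real^'n^'m"
  by (induction I rule: infinite_finite_induct) (simp_all add: matrix_vector_right_distrib)

lemma transpose_sum: "transpose (\<Sum>i\<in>I. B i) = (\<Sum>i\<in>I. transpose (B i))"
  by (simp add: transpose_def vec_eq_iff)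

lemma tendsto_matrix_matrix_mult:
  fixes A :: "'t \<Rightarrow> real^'n^'m" and B :: "'t \<Rightarrow> real^'p^'n"
  assumes "(A \<longlongrightarrow> a) F" "(B \<longlongrightarrow> b) F"
  shows "((\<lambda>t. A t ** B t) \<longlongrightarrow> a ** b) F"
  unfolding matrix_matrix_mult_def
  by (intro vec_tendstoI) (auto intro!: tendsto_intros tendsto_vec_nth assms)

lemma tendsto_matrix_vector_mult:
  fixes A :: "'t \<Rightarrow> real^'n^'m"
  assumes "(A \<longlongrightarrow> a) F" "(x \<longlongrightarrow> u) F"
  shows "((\<lambda>t. A t *v x t) \<longlongrightarrow> a *v u) F"
  unfolding matrix_vector_mult_def
  by (intro vec_tendstoI) (auto intro!: tendsto_intros tendsto_vec_nth assms)

lemma tendsto_transpose: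
  fixes A :: "'t \<Rightarrow> real^'n^'m"
  assumes "(A \<longlongrightarrow> a) F"
  shows "((\<lambda>t. transpose (A t)) \<longlongrightarrow> transpose a) F"
  unfolding transpose_def
  by (intro vec_tendstoI) (auto intro!: tendsto_vec_nth assms)


section \<open>Empirical means and covariances\<close>

lemma sample_mean_add: "sample_mean N (\<lambda>i. x i + y i) = sample_mean N x + sample_mean N y"
  by (simp add: sample_mean_def sum.distrib scaleR_add_right)

lemma sample_mean_mult: "sample_mean N (\<lambda>i. F *v x i) = F *v sample_mean N x"
  by (simp add: sample_mean_def sum_matrix_vector_mult matrix_vector_mult_scaleR)

lemma sample_mean_const: "N \<ge> 1 \<Longrightarrow> sample_mean N (\<lambda>i. c) = c"
  by (simp add: sample_mean_def sum_constant_scaleR del: sum_constant)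

text \<open>This is the polarization of \<open>sample_cov\<close>; it is what makes the covariance of a sum of
  states and noises expand bilinearly.\<close>

definition sample_cross_cov :: "nat \<Rightarrow> (nat \<Rightarrow> real^'m) \<Rightarrow> (nat \<Rightarrow> real^'n) \<Rightarrow> real^'n^'m" where
  "sample_cross_cov N x y = (1 / (real N - 1)) *\<^sub>R
     (\<Sum>i=1..N. outer_product (x i - sample_mean N x) (y i - sample_mean N y))"

lemma sample_cov_eq_cross_cov: "sample_cov N x = sample_cross_cov N x x"
  by (simp add: sample_cov_def sample_cross_cov_def)

lemma sample_cross_cov_transpose: "sample_cross_cov N y x = transpose (sample_cross_cov N x y)"
  by (simp add: sample_cross_cov_def outer_product_transpose[of "y _ - _"] transpose_scalar transpose_sum)

lemma sample_cross_cov_add_left: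
  "sample_cross_cov N (\<lambda>i. x i + x' i) y = sample_cross_cov N x y + sample_cross_cov N x' y"
  by (simp add: sample_cross_cov_def sample_mean_add add_diff_add outer_product_add_left sum.distrib scaleR_add_right)

lemma sample_cross_cov_mult_left: "sample_cross_cov N (\<lambda>i. F *v x i) y = F ** sample_cross_cov N x y"
  by (simp add: sample_cross_cov_def sample_mean_mult matrix_vector_mult_diff_distrib[symmetric]
      outer_product_mult_left sum_matrix_mult_left matrix_mult_distrib)

lemma sample_cross_cov_const_left: "N \<ge> 1 \<Longrightarrow> sample_cross_cov N (\<lambda>i. c) y = 0"
  by (simp add: sample_cross_cov_def sample_mean_const outer_product_zero_left)


section \<open>The ensemble recursion in the large-ensemble limit\<close>

lemma matrix_inv_symmetric:
  fixes R :: "real^'n^'n"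
  assumes "invertible R" and sym: "transpose R = R"
  shows "transpose (matrix_inv R) = matrix_inv R" and "matrix_inv R ** R = mat 1" and "R ** matrix_inv R = mat 1"
proof -
  show 1: "matrix_inv R ** R = mat 1" and 2: "R ** matrix_inv R = mat 1"
    using someI_ex[OF assms(1)[unfolded invertible_def]] by (auto simp: matrix_inv_def)
  have "transpose (matrix_inv R) ** R = mat 1"
    using arg_cong[OF 2, of transpose] by (simp add: matrix_transpose_mul sym)
  then have "(transpose (matrix_inv R) ** R) ** matrix_inv R = matrix_inv R" by simp
  then show "transpose (matrix_inv R) = matrix_inv R"
    by (simp add: matrix_mul_assoc[symmetric] 2)
qed

text \<open>Here \<open>K\<close> is the Kalman gain, and \<open>F\<close>, \<open>R1h\<close>, \<open>G\<close> are the coefficients of the state and of the two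
  noises in one particle step. The perturbed observations contribute \<open>G G\<^sup>T = P S P\<close>, which turns the
  term \<open>- 2 P S P\<close> of first order in the mesh coming from \<open>F P F\<^sup>T\<close> into the \<open>- P S P\<close> of the Riccati drift.\<close>

lemma kb_cov_Suc_eq:
  fixes A R1h :: "real^'x^'x" and C :: "real^'x^'y" and R2h :: "real^'y^'y"
  assumes "transpose R1h = R1h" "transpose R2h = R2h" "invertible R2h"
    and P: "P = kb_cov A C R1h R2h P0 l k" and sym: "transpose P = P"
    and K: "K = P ** transpose C ** matrix_inv (R2h ** R2h)"
    and F: "F = mat 1 + mesh l *\<^sub>R (A - K ** C)" and G: "G = - (K ** R2h)"
  shows "kb_cov A C R1h R2h P0 l (Suc k)
    = F ** P ** transpose F + mesh l *\<^sub>R (R1h ** transpose R1h) + mesh l *\<^sub>R (G ** transpose G)"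
proof -
  define Q where "Q = matrix_inv (R2h ** R2h)"
  have inv: "invertible (R2h ** R2h)" using assms(3) by (simp add: invertible_mult)
  have "transpose (R2h ** R2h) = R2h ** R2h" by (simp add: matrix_transpose_mul assms(2))
  note Q = matrix_inv_symmetric[OF inv this, folded Q_def]
  define S where "S = obs_information C R2h"
  have S: "S = transpose C ** Q ** C" by (simp add: S_def obs_information_def Q_def)
  have symS: "transpose S = S" by (simp add: S matrix_transpose_mul Q(1) matrix_mul_assoc)
  have KC: "K ** C = P ** S" by (simp add: K S Q_def matrix_mul_assoc)
  have "G ** transpose G = P ** transpose C ** (Q ** (R2h ** R2h)) ** Q ** C ** P"
    by (simp add: G K Q_def[symmetric] matrix_mult_distrib transpose_linear matrix_transpose_mul
        assms(2) sym Q(1) matrix_mul_assoc)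
  then have GG: "G ** transpose G = P ** S ** P" unfolding Q(2) by (simp add: S matrix_mul_assoc)
  have tF: "transpose F = mat 1 + mesh l *\<^sub>R (transpose A - S ** P)"
    by (simp add: F KC transpose_linear matrix_transpose_mul sym symS)
  have quadratic: "(mat 1 + c *\<^sub>R B) ** P ** (mat 1 + c *\<^sub>R B')
      = P + c *\<^sub>R (B ** P + P ** B') + c\<^sup>2 *\<^sub>R (B ** P ** B')" for B B' and c
    by (simp add: matrix_mult_distrib scaleR_add_right power2_eq_square matrix_mul_assoc add_ac)
  have "F ** P ** transpose F = P + mesh l *\<^sub>R ((A - P ** S) ** P + P ** (transpose A - S ** P))
      + (mesh l)\<^sup>2 *\<^sub>R ((A - P ** S) ** P ** (transpose A - S ** P))"
    unfolding tF unfolding F KC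
    by (simp add: quadratic)
  moreover have "(A - P ** S) ** P + P ** (transpose A - S ** P) + R1h ** R1h + P ** S ** P = Ricc A C R1h R2h P"
    by (simp add: Ricc_def S_def[symmetric] matrix_mult_distrib matrix_mul_assoc)
  ultimately show ?thesis
    by (simp add: P[symmetric] S_def[symmetric] Let_def assms(1) GG scaleR_add_right[symmetric] add_ac)
qed

text \<open>The coefficients vary with \<open>N\<close> because they contain the gain of the \<open>N\<close>-particle system; they converge
  because the gain is a continuous function of the sample covariance.\<close>

lemma ensemble_step_mean:
  fixes x x' :: "nat \<Rightarrow> nat \<Rightarrow> real^'x" and w :: "nat \<Rightarrow> real^'w" and v :: "nat \<Rightarrow> real^'v"
  assumes step: "\<And>N i. x' N i = F N *v x N i + R *v w i + G N *v v i + c N"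
    and lim: "F \<longlonglongrightarrow> F'" "G \<longlonglongrightarrow> G'" "c \<longlonglongrightarrow> c'" "(\<lambda>N. sample_mean N (x N)) \<longlonglongrightarrow> m"
      "(\<lambda>N. sample_mean N w) \<longlonglongrightarrow> 0" "(\<lambda>N. sample_mean N v) \<longlonglongrightarrow> 0"
  shows "(\<lambda>N. sample_mean N (x' N)) \<longlonglongrightarrow> F' *v m + c'"
proof (rule Lim_transform_eventually)
  have "(\<lambda>N. F N *v sample_mean N (x N) + R *v sample_mean N w + G N *v sample_mean N v + c N)
      \<longlonglongrightarrow> F' *v m + R *v 0 + G' *v 0 + c'"
    by (intro tendsto_add tendsto_matrix_vector_mult tendsto_const lim)
  then show "(\<lambda>N. F N *v sample_mean N (x N) + R *v sample_mean N w + G N *v sample_mean N v + c N)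
      \<longlonglongrightarrow> F' *v m + c'" by simp
  have x': "x' N = (\<lambda>i. F N *v x N i + R *v w i + G N *v v i + c N)" for N using step by auto
  show "\<forall>\<^sub>F N in sequentially. F N *v sample_mean N (x N) + R *v sample_mean N w + G N *v sample_mean N v + c N
      = sample_mean N (x' N)"
    using eventually_ge_at_top[of 1]
    by eventually_elim (simp add: x' sample_mean_add sample_mean_mult sample_mean_const)
qed

text \<open>The sequence \<open>z\<close> stands for a noise increment or for the ensemble itself, before or after the step.\<close>

lemma ensemble_step_cross_cov:
  fixes x x' :: "nat \<Rightarrow> nat \<Rightarrow> real^'x" and w :: "nat \<Rightarrow> real^'w" and v :: "nat \<Rightarrow> real^'v"
    and z :: "nat \<Rightarrow> nat \<Rightarrow> real^'z"
  assumes step: "\<And>N i. x' N i = F N *v x N i + R *v w i + G N *v v i + c N"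
    and lim: "F \<longlonglongrightarrow> F'" "G \<longlonglongrightarrow> G'" "(\<lambda>N. sample_cross_cov N (x N) (z N)) \<longlonglongrightarrow> a"
      "(\<lambda>N. sample_cross_cov N w (z N)) \<longlonglongrightarrow> b" "(\<lambda>N. sample_cross_cov N v (z N)) \<longlonglongrightarrow> d"
  shows "(\<lambda>N. sample_cross_cov N (x' N) (z N)) \<longlonglongrightarrow> F' ** a + R ** b + G' ** d"
proof (rule Lim_transform_eventually)
  show "(\<lambda>N. F N ** sample_cross_cov N (x N) (z N) + R ** sample_cross_cov N w (z N)
      + G N ** sample_cross_cov N v (z N)) \<longlonglongrightarrow> F' ** a + R ** b + G' ** d"
    by (intro tendsto_add tendsto_matrix_matrix_mult tendsto_const lim)
  have x': "x' N = (\<lambda>i. F N *v x N i + R *v w i + G N *v v i + c N)" for N using step by auto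
  show "\<forall>\<^sub>F N in sequentially. F N ** sample_cross_cov N (x N) (z N) + R ** sample_cross_cov N w (z N)
      + G N ** sample_cross_cov N v (z N) = sample_cross_cov N (x' N) (z N)"
    using eventually_ge_at_top[of 1] by eventually_elim
      (simp add: x' sample_cross_cov_add_left sample_cross_cov_mult_left sample_cross_cov_const_left)
qed

lemma tendsto_cross_cov_swap:
  assumes "(\<lambda>N. sample_cross_cov N (x N) (y N)) \<longlonglongrightarrow> a"
  shows "(\<lambda>N. sample_cross_cov N (y N) (x N)) \<longlonglongrightarrow> transpose a"
  using tendsto_transpose[OF assms] by (simp add: sample_cross_cov_transpose[symmetric])

text \<open>This gives the symmetry of the limiting covariances \<open>P\<^sub>k\<close> that the matrix computations rely on.\<close>

lemma limit_sample_cov_symmetric: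
  assumes "(\<lambda>N. sample_cov N (x N)) \<longlonglongrightarrow> P"
  shows "transpose P = P"
  using LIMSEQ_unique[OF tendsto_cross_cov_swap[OF assms[unfolded sample_cov_eq_cross_cov]]]
    assms[unfolded sample_cov_eq_cross_cov] by blast

lemma transpose_zero: "transpose 0 = 0"
  by (simp add: transpose_def vec_eq_iff)

text \<open>Bilinearity is used in one argument at a time: the cross-covariances of the new states with
  the old states and with the two noises give, in turn, the covariance of the new states.\<close>

lemma ensemble_step_cov:
  fixes x x' :: "nat \<Rightarrow> nat \<Rightarrow> real^'x" and w :: "nat \<Rightarrow> real^'w" and v :: "nat \<Rightarrow> real^'v"
  assumes step: "\<And>N i. x' N i = F N *v x N i + R *v w i + G N *v v i + c N"
    and F: "F \<longlonglongrightarrow> F'" and G: "G \<longlonglongrightarrow> G'" and xx: "(\<lambda>N. sample_cov N (x N)) \<longlonglongrightarrow> P"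
    and ww: "(\<lambda>N. sample_cross_cov N w w) \<longlonglongrightarrow> s *\<^sub>R mat 1"
    and vv: "(\<lambda>N. sample_cross_cov N v v) \<longlonglongrightarrow> s *\<^sub>R mat 1"
    and xw: "(\<lambda>N. sample_cross_cov N (x N) w) \<longlonglongrightarrow> 0"
    and xv: "(\<lambda>N. sample_cross_cov N (x N) v) \<longlonglongrightarrow> 0"
    and wv: "(\<lambda>N. sample_cross_cov N w v) \<longlonglongrightarrow> 0"
  shows "(\<lambda>N. sample_cov N (x' N)) \<longlonglongrightarrow> F' ** P ** transpose F' + s *\<^sub>R (R ** transpose R) + s *\<^sub>R (G' ** transpose G')"
proof -
  note swap = tendsto_cross_cov_swap and cross = ensemble_step_cross_cov[OF step F G]
  have wx: "(\<lambda>N. sample_cross_cov N w (x N)) \<longlonglongrightarrow> 0" and vx: "(\<lambda>N. sample_cross_cov N v (x N)) \<longlonglongrightarrow> 0"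
    and vw: "(\<lambda>N. sample_cross_cov N v w) \<longlonglongrightarrow> 0"
    using swap[OF xw] swap[OF xv] swap[OF wv] by (simp_all add: transpose_zero)
  have "(\<lambda>N. sample_cross_cov N (x' N) (x N)) \<longlonglongrightarrow> F' ** P"
    and "(\<lambda>N. sample_cross_cov N (x' N) w) \<longlonglongrightarrow> s *\<^sub>R R"
    and "(\<lambda>N. sample_cross_cov N (x' N) v) \<longlonglongrightarrow> s *\<^sub>R G'"
    using cross[OF xx[unfolded sample_cov_eq_cross_cov] wx vx] cross[OF xw ww vw] cross[OF xv wv vv]
    by (simp_all add: matrix_mult_distrib)
  note cross' = ensemble_step_cross_cov[OF step F G swap[OF this(1)] swap[OF this(2)] swap[OF this(3)]]
  show ?thesis
    unfolding sample_cov_eq_cross_cov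
    using cross' limit_sample_cov_symmetric[OF xx]
    by (simp add: matrix_mul_assoc matrix_transpose_mul transpose_linear matrix_mult_distrib)
qed


text \<open>A statement about fixed paths. The induction proves more than the conclusion: the gain depends on
  the sample covariance, so its limit is carried along, and propagating that limit requires that the
  ensemble be asymptotically uncorrelated with the noise of the current and later steps.\<close>

lemma enkf_mean_tendsto_kb_mean:
  fixes A R1h P0 :: "real^'x^'x" and C :: "real^'x^'y" and R2h :: "real^'y^'y" and m0 :: "real^'x"
    and w :: "nat \<Rightarrow> real \<Rightarrow> real^'x" and v :: "nat \<Rightarrow> real \<Rightarrow> real^'y" and y :: "real \<Rightarrow> real^'y" and x0 :: "nat \<Rightarrow> real^'x"
  assumes R: "transpose R1h = R1h" "transpose R2h = R2h" "invertible R2h"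
    and dw: "\<And>j i. dw j i = grid_increment l (w i) j" and dv: "\<And>j i. dv j i = grid_increment l (v i) j"
    and mean: "(\<lambda>N. sample_mean N x0) \<longlonglongrightarrow> m0" "\<And>j. (\<lambda>N. sample_mean N (dw j)) \<longlonglongrightarrow> 0"
      "\<And>j. (\<lambda>N. sample_mean N (dv j)) \<longlonglongrightarrow> 0"
    and x0: "(\<lambda>N. sample_cross_cov N x0 x0) \<longlonglongrightarrow> P0" "\<And>j. (\<lambda>N. sample_cross_cov N x0 (dw j)) \<longlonglongrightarrow> 0"
      "\<And>j. (\<lambda>N. sample_cross_cov N x0 (dv j)) \<longlonglongrightarrow> 0"
    and ww: "\<And>j j'. (\<lambda>N. sample_cross_cov N (dw j) (dw j')) \<longlonglongrightarrow> (if j = j' then mesh l *\<^sub>R mat 1 else 0)"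
    and vv: "\<And>j j'. (\<lambda>N. sample_cross_cov N (dv j) (dv j')) \<longlonglongrightarrow> (if j = j' then mesh l *\<^sub>R mat 1 else 0)"
    and wv: "\<And>j j'. (\<lambda>N. sample_cross_cov N (dw j) (dv j')) \<longlonglongrightarrow> 0"
  defines "\<xi> \<equiv> \<lambda>k N. enkf_particles A C R1h R2h l N y w v x0 k"
  shows "(\<lambda>N. sample_mean N (\<xi> k N)) \<longlonglongrightarrow> kb_mean A C R1h R2h m0 P0 l y k"
proof -
  have "(\<lambda>N. sample_mean N (\<xi> k N)) \<longlonglongrightarrow> kb_mean A C R1h R2h m0 P0 l y k
    \<and> (\<lambda>N. sample_cov N (\<xi> k N)) \<longlonglongrightarrow> kb_cov A C R1h R2h P0 l k
    \<and> (\<forall>j\<ge>k. (\<lambda>N. sample_cross_cov N (\<xi> k N) (dw j)) \<longlonglongrightarrow> 0)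
    \<and> (\<forall>j\<ge>k. (\<lambda>N. sample_cross_cov N (\<xi> k N) (dv j)) \<longlonglongrightarrow> 0)"
  proof (induction k)
    case 0
    show ?case using mean(1) x0 by (simp add: \<xi>_def sample_cov_eq_cross_cov)
  next
    case (Suc k)
    define P where "P = kb_cov A C R1h R2h P0 l k"
    define gain where "gain Q = Q ** transpose C ** matrix_inv (R2h ** R2h)" for Q :: "real^'x^'x"
    define F where "F Q = mat 1 + mesh l *\<^sub>R (A - gain Q ** C)" for Q
    define G where "G Q = - (gain Q ** R2h)" for Q
    define c where "c Q = gain Q *v grid_increment l y k" for Q
    let ?P = "\<lambda>N. sample_cov N (\<xi> k N)"
    have IH: "(\<lambda>N. sample_mean N (\<xi> k N)) \<longlonglongrightarrow> kb_mean A C R1h R2h m0 P0 l y k"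
      "?P \<longlonglongrightarrow> P"
      "\<And>j. j \<ge> k \<Longrightarrow> (\<lambda>N. sample_cross_cov N (\<xi> k N) (dw j)) \<longlonglongrightarrow> 0"
      "\<And>j. j \<ge> k \<Longrightarrow> (\<lambda>N. sample_cross_cov N (\<xi> k N) (dv j)) \<longlonglongrightarrow> 0"
      using Suc.IH by (auto simp: P_def)
    have step: "\<xi> (Suc k) N i = F (?P N) *v \<xi> k N i + R1h *v dw k i + G (?P N) *v dv k i + c (?P N)" for N i
      by (simp add: \<xi>_def Let_def F_def G_def c_def gain_def[symmetric] dw dv matrix_vector_mult_add_rdistrib
          matrix_vector_mult_diff_rdistrib matrix_vector_mult_scaleR_left matrix_vector_mult_minus_left
          matrix_vector_mult_diff_distrib matrix_vector_right_distrib matrix_vector_mul_assoc[symmetric]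
          matrix_vector_mult_scaleR scaleR_diff_right)
    have gain: "(\<lambda>N. gain (?P N)) \<longlonglongrightarrow> gain P"
      unfolding gain_def by (intro tendsto_matrix_matrix_mult IH tendsto_const)
    have F: "(\<lambda>N. F (?P N)) \<longlonglongrightarrow> F P" unfolding F_def
      by (intro tendsto_intros tendsto_matrix_matrix_mult gain)
    have G: "(\<lambda>N. G (?P N)) \<longlonglongrightarrow> G P" unfolding G_def
      by (intro tendsto_intros tendsto_matrix_matrix_mult gain)
    have c: "(\<lambda>N. c (?P N)) \<longlonglongrightarrow> c P" unfolding c_def
      by (intro tendsto_matrix_vector_mult tendsto_const gain)
    have "(\<lambda>N. sample_mean N (\<xi> (Suc k) N)) \<longlonglongrightarrow> F P *v kb_mean A C R1h R2h m0 P0 l y k + c P"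
      by (rule ensemble_step_mean[OF step F G c IH(1) mean(2,3)])
    moreover have "F P *v m + c P = m + mesh l *\<^sub>R (A *v m) + gain P *v (grid_increment l y k - mesh l *\<^sub>R (C *v m))" for m
      by (simp add: F_def c_def matrix_vector_mult_add_rdistrib
          matrix_vector_mult_diff_rdistrib matrix_vector_mult_scaleR_left
          matrix_vector_mult_diff_distrib matrix_vector_mul_assoc[symmetric]
          matrix_vector_mult_scaleR scaleR_diff_right)
    moreover have "(\<lambda>N. sample_cov N (\<xi> (Suc k) N)) \<longlonglongrightarrow> kb_cov A C R1h R2h P0 l (Suc k)"
      unfolding kb_cov_Suc_eq[OF R P_def limit_sample_cov_symmetric[OF IH(2)] gain_def F_def G_def]
      using ensemble_step_cov[OF step F G IH(2) _ _ IH(3,4) wv] ww[of k k] vv[of k k] by simp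
    moreover have "(\<lambda>N. sample_cross_cov N (\<xi> (Suc k) N) (dw j)) \<longlonglongrightarrow> 0" if "j \<ge> Suc k" for j
      using ensemble_step_cross_cov[OF step F G IH(3)[of j] ww tendsto_cross_cov_swap[OF wv]] that
      by (simp add: transpose_zero)
    moreover have "(\<lambda>N. sample_cross_cov N (\<xi> (Suc k) N) (dv j)) \<longlonglongrightarrow> 0" if "j \<ge> Suc k" for j
      using ensemble_step_cross_cov[OF step F G IH(4)[of j] wv vv] that by simp
    ultimately show ?case
      by (simp add: Let_def P_def gain_def)
  qed
  then show "(\<lambda>N. sample_mean N (\<xi> k N)) \<longlonglongrightarrow> kb_mean A C R1h R2h m0 P0 l y k" by blast
qed


section \<open>Factorization of positive semidefinite matrices\<close>

lemma sym_psd_commute: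
  assumes "sym_psd P"
  shows "P $ a $ b = P $ b $ a"
proof -
  have "transpose P $ b $ a = P $ b $ a" using assms by (simp add: sym_psd_def)
  then show ?thesis by (simp add: transpose_def)
qed

text \<open>Otherwise the quadratic form at \<open>e\<^sub>a + t e\<^sub>s\<close>, which is affine in \<open>t\<close> when the diagonal entry vanishes,
  would be negative for suitable \<open>t\<close>.\<close>

lemma sym_psd_diag_zero:
  fixes P :: "real^'n^'n"
  assumes "sym_psd P" "P $ s $ s = 0"
  shows "P $ a $ s = 0" "P $ s $ a = 0"
proof -
  note sym = sym_psd_commute[OF assms(1), of s a]
  have q: "0 \<le> P $ a $ a + 2 * t * P $ a $ s" for t
  proof -
    let ?u = "axis a 1 + t *\<^sub>R axis s 1 :: real^'n"
    have "?u \<bullet> (P *v ?u) = P $ a $ a + 2 * t * P $ a $ s"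
      using sym assms(2)
      by (simp add: matrix_vector_right_distrib matrix_vector_mult_scaleR inner_add_left inner_axis'
          matrix_vector_mult_basis column_def algebra_simps)
    then show ?thesis using assms(1) by (metis sym_psd_def)
  qed
  show "P $ a $ s = 0"
  proof (rule ccontr)
    assume "P $ a $ s \<noteq> 0"
    with q[of "- (P $ a $ a + 1) / (2 * P $ a $ s)"] show False by (simp add: field_simps)
  qed
  with sym show "P $ s $ a = 0" by simp
qed

text \<open>One elimination step. Its result stays positive semidefinite because
  its quadratic form at \<open>x\<close> is that of \<open>P\<close> at \<open>x - c e\<^sub>s\<close>, with \<open>c\<close> chosen to minimize
  the latter (completing the square).\<close>

lemma sym_psd_schur_complement:
  fixes P :: "real^'n^'n"
  assumes psd: "sym_psd P" and pos: "P $ s $ s > 0"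
  defines "u \<equiv> (1 / sqrt (P $ s $ s)) *\<^sub>R column s P"
  shows "sym_psd (P - outer_product u u)"
proof -
  have P: "transpose P = P" using psd by (simp add: sym_psd_def)
  have tP: "x \<bullet> (P *v y) = y \<bullet> (P *v x)" for x y
    by (metis P dot_lmul_matrix inner_commute transpose_matrix_vector)
  have "0 \<le> x \<bullet> ((P - outer_product u u) *v x)" for x
  proof -
    define e where "e = (axis s 1 :: real^'n)"
    have Pe: "P *v e = column s P" unfolding e_def by (simp add: matrix_vector_mult_basis)
    have ePe: "e \<bullet> (P *v e) = P $ s $ s" unfolding Pe by (simp add: e_def inner_axis' column_def)
    define c where "c = (x \<bullet> column s P) / P $ s $ s"
    have "outer_product u u *v x = (u \<bullet> x) *\<^sub>R u"
      by (simp add: outer_product_def matrix_vector_mult_def vec_eq_iff inner_vec_def sum_distrib_left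
          sum_distrib_right mult_ac)
    then have "x \<bullet> ((P - outer_product u u) *v x) = x \<bullet> (P *v x) - (u \<bullet> x)\<^sup>2"
      by (simp add: matrix_vector_mult_diff_rdistrib inner_diff_right power2_eq_square inner_commute)
    also have "(u \<bullet> x)\<^sup>2 = (x \<bullet> column s P)\<^sup>2 / P $ s $ s"
      using pos by (simp add: u_def power_divide inner_commute)
    also have "x \<bullet> (P *v x) - (x \<bullet> column s P)\<^sup>2 / P $ s $ s = (x - c *\<^sub>R e) \<bullet> (P *v (x - c *\<^sub>R e))"
      using pos tP[of e x] unfolding c_def
      by (simp add: matrix_vector_mult_diff_distrib matrix_vector_mult_scaleR inner_diff_left inner_diff_right
          ePe Pe[symmetric] field_simps power2_eq_square)
    finally show ?thesis using psd by (simp add: sym_psd_def)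
  qed
  moreover have "transpose (P - outer_product u u) = P - outer_product u u"
    by (simp add: transpose_linear P outer_product_transpose[symmetric])
  ultimately show ?thesis by (simp add: sym_psd_def)
qed

text \<open>Elimination of the coordinates in \<open>S\<close> one by one; the support of the matrix shrinks with each of
  them.\<close>

lemma sym_psd_sum_outer_products:
  fixes P :: "real^'n^'n"
  assumes "finite S" "sym_psd P" "\<And>a b. a \<notin> S \<or> b \<notin> S \<Longrightarrow> P $ a $ b = 0"
  shows "\<exists>u. P = (\<Sum>s\<in>S. outer_product (u s) (u s))"
  using assms
proof (induction S arbitrary: P rule: finite_induct)
  case empty
  then show ?case by (simp add: vec_eq_iff)
next
  case (insert s S)
  note psd = insert.prems(1)
  note sym = sym_psd_commute[OF psd]
  have "\<exists>z. sym_psd (P - outer_product z z) \<and> (\<forall>a b. a \<notin> S \<or> b \<notin> S \<longrightarrow> (P - outer_product z z) $ a $ b = 0)"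
  proof (cases "P $ s $ s = 0")
    case True
    have "P $ a $ b = 0" if "a \<notin> S \<or> b \<notin> S" for a b
      using sym_psd_diag_zero[OF psd True] insert.prems(2)[of a b] that by (cases "a = s \<or> b = s") auto
    \<comment> \<open>A zero pivot comes with a zero row and column, so there is nothing to subtract.\<close>
    then show ?thesis
      using psd by (intro exI[of _ 0]) (simp add: outer_product_zero_left)
  next
    case False
    have "0 \<le> axis s 1 \<bullet> (P *v axis s 1)" using psd by (simp add: sym_psd_def)
    with False have pos: "P $ s $ s > 0"
      by (simp add: matrix_vector_mult_basis inner_axis' column_def)
    let ?z = "(1 / sqrt (P $ s $ s)) *\<^sub>R column s P"
    have z: "outer_product ?z ?z $ a $ b = P $ a $ s * P $ b $ s / P $ s $ s" for a b
      using pos by (simp add: outer_product_def column_def)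
    have "(P - outer_product ?z ?z) $ a $ b = 0" if "a \<notin> S \<or> b \<notin> S" for a b
      using that pos insert.prems(2)[of a b] insert.prems(2)[of a s] insert.prems(2)[of b s] sym[of s b]
      by (cases "a = s"; cases "b = s") (auto simp: z)
    with sym_psd_schur_complement[OF psd pos] show ?thesis by blast
  qed
  then obtain z where z: "sym_psd (P - outer_product z z)"
    "\<And>a b. a \<notin> S \<or> b \<notin> S \<Longrightarrow> (P - outer_product z z) $ a $ b = 0" by blast
  from insert.IH[OF this] obtain u where u: "P - outer_product z z = (\<Sum>t\<in>S. outer_product (u t) (u t))" by blast
  have "(\<Sum>t\<in>insert s S. outer_product ((u(s := z)) t) ((u(s := z)) t)) = outer_product z z + (\<Sum>t\<in>S. outer_product (u t) (u t))"
    using insert.hyps by (subst sum.insert) (auto intro!: sum.cong)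
  with u show ?case by (intro exI[of _ "u(s := z)"]) (simp add: algebra_simps)
qed

lemma sym_psd_factorization:
  fixes P :: "real^'n^'n"
  assumes "sym_psd P"
  shows "\<exists>L :: real^'n^'n. L ** transpose L = P"
proof -
  have "\<exists>u. P = (\<Sum>s\<in>(UNIV :: 'n set). outer_product (u s) (u s))"
    by (rule sym_psd_sum_outer_products[OF finite assms]) simp
  then obtain u where u: "P = (\<Sum>s\<in>(UNIV :: 'n set). outer_product (u s) (u s))" by blast
  have "(\<chi> a s. u s $ a) ** transpose (\<chi> a s. u s $ a) = P"
    unfolding u by (simp add: matrix_matrix_mult_def transpose_def outer_product_def vec_eq_iff)
  then show ?thesis by blast
qed

lemma scalar_matrix_factorization:
  assumes "s \<ge> 0"
  shows "\<exists>L :: real^'n^'n. L ** transpose L = s *\<^sub>R mat 1"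
  using assms by (intro exI[of _ "sqrt s *\<^sub>R mat 1"]) (simp add: transpose_linear matrix_mult_distrib)


section \<open>Almost sure limits of empirical covariances\<close>

text \<open>The measures \<open>H i\<close> only serve as carriers of \<open>\<sigma>\<close>-algebras; measurability with respect to \<open>H i\<close> says that
  a variable is a function of the information in \<open>H i\<close>.\<close>

lemma (in prob_space) indep_vars_if_indep_sets:
  assumes indep: "indep_sets (\<lambda>i. sets (H i)) I" and space: "\<And>i. i \<in> I \<Longrightarrow> space (H i) = space M"
    and X: "\<And>i. i \<in> I \<Longrightarrow> X i \<in> measurable (H i) (N i)"
  shows "indep_vars N X I"
  unfolding indep_vars_def2
proof
  have H: "sets (H i) \<subseteq> events" if "i \<in> I" for i
    using indep that by (auto simp: indep_sets_def)
  have *: "X i -` A \<inter> space M \<in> sets (H i)" if "i \<in> I" "A \<in> sets (N i)" for i A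
    using measurable_sets[OF X that(2)] that(1) space by metis
  show "\<forall>i\<in>I. random_variable (N i) (X i)"
    using * H measurable_space[OF X] space by (intro ballI measurableI) (blast | metis)+
  show "indep_sets (\<lambda>i. {X i -` A \<inter> space M |A. A \<in> sets (N i)}) I"
    by (rule indep_sets_mono_sets[OF indep]) (use * in auto)
qed

text \<open>The variables are real-valued so that it applies to components of vectors of different
  dimensions.\<close>

lemma (in prob_space) expectation_mult_if_indep_sets:
  fixes X Y :: "'a \<Rightarrow> real"
  assumes indep: "indep_sets (\<lambda>i. sets (H i)) I" and space: "\<And>i. i \<in> I \<Longrightarrow> space (H i) = space M"
    and s: "s \<in> I" "s' \<in> I" "s \<noteq> s'"
    and X: "X \<in> borel_measurable (H s)" "integrable M X"
    and Y: "Y \<in> borel_measurable (H s')" "integrable M Y"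
  shows "expectation (\<lambda>\<omega>. X \<omega> * Y \<omega>) = expectation X * expectation Y"
proof -
  have "indep_sets (\<lambda>i. sets (H i)) {s, s'}"
    using s by (intro indep_sets_mono_index[OF _ indep]) auto
  then have "indep_vars (\<lambda>_. borel) (\<lambda>i. if i = s then X else Y) {s, s'}"
    using s X Y by (intro indep_vars_if_indep_sets[where H = H] space) auto
  from indep_vars_lebesgue_integral[OF _ this] show ?thesis
    using s X Y by auto
qed

lemma borel_measurable_vec_nth: "(\<lambda>x. x $ a) \<in> borel_measurable (borel :: (real^'n) measure)"
  by simp

lemma has_all_moments_component_if_gaussian:
  assumes [measurable]: "U \<in> borel_measurable M" and law: "distr M borel U = gaussian_measure m P"
  shows "has_all_moments M (\<lambda>\<omega>. U \<omega> $ a)"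
    and "f \<in> borel_measurable borel \<Longrightarrow> (\<integral>\<omega>. f (U \<omega>) \<partial>M) = (\<integral>x. f x \<partial>gaussian_measure m P :: real)"
  using gaussian_measure_moments(3)[of m P a] unfolding law[symmetric]
  by (simp_all add: has_all_moments_distr integral_distr)

lemma AE_tendsto_vecI:
  fixes f :: "nat \<Rightarrow> 'a \<Rightarrow> 'b::topological_space^'n"
  assumes "\<And>a. AE \<omega> in M. (\<lambda>N. f N \<omega> $ a) \<longlonglongrightarrow> l $ a"
  shows "AE \<omega> in M. (\<lambda>N. f N \<omega>) \<longlonglongrightarrow> l"
proof -
  have "AE \<omega> in M. \<forall>a. (\<lambda>N. f N \<omega> $ a) \<longlonglongrightarrow> l $ a"
    unfolding AE_all_countable using assms by blast
  then show ?thesis by eventually_elim (auto intro: vec_tendstoI)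
qed

text \<open>The empirical form of \<open>E(XY) - E(X) E(Y)\<close>, with the factor that corrects the bias.\<close>

lemma sample_cross_cov_component:
  assumes "N \<ge> 2"
  shows "sample_cross_cov N x y $ a $ b = real N / (real N - 1) *
    ((\<Sum>i=1..N. x i $ a * y i $ b) / real N - sample_mean N x $ a * sample_mean N y $ b)"
proof -
  let ?mx = "sample_mean N x $ a" and ?my = "sample_mean N y $ b"
  have m: "(\<Sum>i=1..N. x i $ a) = real N * ?mx" "(\<Sum>i=1..N. y i $ b) = real N * ?my"
    using assms by (simp_all add: sample_mean_def)
  have "sample_cross_cov N x y $ a $ b = (\<Sum>i=1..N. (x i $ a - ?mx) * (y i $ b - ?my)) / (real N - 1)"
    by (simp add: sample_cross_cov_def outer_product_def)
  also have "(\<Sum>i=1..N. (x i $ a - ?mx) * (y i $ b - ?my))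
    = (\<Sum>i=1..N. x i $ a * y i $ b) - ?mx * (\<Sum>i=1..N. y i $ b) - ?my * (\<Sum>i=1..N. x i $ a) + real N * (?mx * ?my)"
    by (simp add: algebra_simps sum.distrib sum_subtractf sum_distrib_left)
  also have "\<dots> = (\<Sum>i=1..N. x i $ a * y i $ b) - real N * (?mx * ?my)"
    unfolding m by simp
  also have "\<dots> / (real N - 1) = real N / (real N - 1) * ((\<Sum>i=1..N. x i $ a * y i $ b) / real N - ?mx * ?my)"
    using assms by (simp add: field_simps)
  finally show ?thesis .
qed

lemma sample_cross_cov_tendsto:
  assumes x: "(\<lambda>N. sample_mean N x) \<longlonglongrightarrow> m" and y: "(\<lambda>N. sample_mean N y) \<longlonglongrightarrow> m'"
    and xy: "\<And>a b. (\<lambda>N. (\<Sum>i=1..N. x i $ a * y i $ b) / real N) \<longlonglongrightarrow> \<Gamma> $ a $ b + m $ a * m' $ b"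
  shows "(\<lambda>N. sample_cross_cov N x y) \<longlonglongrightarrow> \<Gamma>"
proof (intro vec_tendstoI)
  fix a b
  have "(\<lambda>N. real N / (real N - 1)) \<longlonglongrightarrow> 1" by real_asymp
  then have "(\<lambda>N. real N / (real N - 1) *
      ((\<Sum>i=1..N. x i $ a * y i $ b) / real N - sample_mean N x $ a * sample_mean N y $ b))
    \<longlonglongrightarrow> 1 * ((\<Gamma> $ a $ b + m $ a * m' $ b) - m $ a * m' $ b)"
    by (intro tendsto_mult tendsto_diff tendsto_vec_nth x y xy)
  moreover have "\<forall>\<^sub>F N in sequentially. real N / (real N - 1) *
      ((\<Sum>i=1..N. x i $ a * y i $ b) / real N - sample_mean N x $ a * sample_mean N y $ b)
      = sample_cross_cov N x y $ a $ b"
    using eventually_ge_at_top[of 2] by eventually_elim (simp add: sample_cross_cov_component)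
  ultimately show "(\<lambda>N. sample_cross_cov N x y $ a $ b) \<longlonglongrightarrow> \<Gamma> $ a $ b"
    using Lim_transform_eventually by fastforce
qed

text \<open>\<open>H i\<close> is the information attached to particle \<open>i\<close>; particles are numbered from \<open>1\<close>.\<close>

locale independent_copies = prob_space +
  fixes H :: "nat \<Rightarrow> 'a measure"
  assumes indep_H: "indep_sets (\<lambda>i. sets (H i)) {1..}"
    and space_H: "\<And>i. space (H i) = space M"
begin

lemma measurable_H: "i \<ge> 1 \<Longrightarrow> X \<in> measurable (H i) N \<Longrightarrow> X \<in> measurable M N"
proof -
  assume "i \<ge> 1" and X: "X \<in> measurable (H i) N"
  then have "sets (H i) \<subseteq> events"
    using indep_H by (simp add: indep_sets_def)
  then show "X \<in> measurable M N"
    using X space_H[of i] by (auto simp: measurable_def)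
qed

lemma AE_sample_mean_gaussian:
  fixes U :: "nat \<Rightarrow> 'a \<Rightarrow> real^'m"
  assumes U: "\<And>i. i \<ge> 1 \<Longrightarrow> U i \<in> borel_measurable (H i)"
    and law: "\<And>i. i \<ge> 1 \<Longrightarrow> distr M borel (U i) = gaussian_measure m P"
  shows "AE \<omega> in M. (\<lambda>N. sample_mean N (\<lambda>i. U i \<omega>)) \<longlonglongrightarrow> m"
proof (rule AE_tendsto_vecI)
  fix a
  have [measurable]: "U i \<in> borel_measurable M" if "i \<ge> 1" for i using U measurable_H that by blast
  note g = has_all_moments_component_if_gaussian[OF _ law]
  have "AE \<omega> in M. (\<lambda>N. (\<Sum>i=1..N. U i \<omega> $ a) / real N) \<longlonglongrightarrow> m $ a"
  proof (rule strong_law_fourth_moment)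
    show "indep_vars (\<lambda>_. borel) (\<lambda>i \<omega>. U i \<omega> $ a) {1..}"
      by (rule indep_vars_if_indep_sets[OF indep_H space_H])
        (auto intro: measurable_compose[OF U(1) borel_measurable_vec_nth])
    fix i :: nat assume i: "i \<ge> 1"
    show "integrable M (\<lambda>\<omega>. U i \<omega> $ a ^ 4)"
      using i by (intro has_all_momentsD(2) g(1)[OF _ i]) auto
    show "expectation (\<lambda>\<omega>. U i \<omega> $ a) = m $ a"
      using g(2)[OF _ i, of "\<lambda>x. x $ a"] i gaussian_measure_moments(4) by auto
    show "expectation (\<lambda>\<omega>. U i \<omega> $ a ^ 4) \<le> (\<integral>x. x $ a ^ 4 \<partial>gaussian_measure m P)"
      using g(2)[OF _ i, of "\<lambda>x. x $ a ^ 4"] i by auto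
  qed
  then show "AE \<omega> in M. (\<lambda>N. sample_mean N (\<lambda>i. U i \<omega>) $ a) \<longlonglongrightarrow> m $ a"
    by (simp add: sample_mean_def)
qed

text \<open>\<open>U i\<close> and \<open>V i\<close> belong to the same particle and may be dependent; the strong law is applied to the
  products of their components, which are independent over the particles.\<close>

lemma AE_sample_cross_cov_gaussian:
  fixes U :: "nat \<Rightarrow> 'a \<Rightarrow> real^'m" and V :: "nat \<Rightarrow> 'a \<Rightarrow> real^'n"
  assumes U: "\<And>i. i \<ge> 1 \<Longrightarrow> U i \<in> borel_measurable (H i)"
      "\<And>i. i \<ge> 1 \<Longrightarrow> distr M borel (U i) = gaussian_measure m P"
    and V: "\<And>i. i \<ge> 1 \<Longrightarrow> V i \<in> borel_measurable (H i)"
      "\<And>i. i \<ge> 1 \<Longrightarrow> distr M borel (V i) = gaussian_measure m' P'"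
    and UV: "\<And>i a b. i \<ge> 1 \<Longrightarrow> expectation (\<lambda>\<omega>. U i \<omega> $ a * V i \<omega> $ b) = \<Gamma> $ a $ b + m $ a * m' $ b"
  shows "AE \<omega> in M. (\<lambda>N. sample_cross_cov N (\<lambda>i. U i \<omega>) (\<lambda>i. V i \<omega>)) \<longlonglongrightarrow> \<Gamma>"
proof -
  have [measurable]: "U i \<in> borel_measurable M" "V i \<in> borel_measurable M" if "i \<ge> 1" for i
    using U(1) V(1) measurable_H that by blast+
  note gU = has_all_moments_component_if_gaussian[OF _ U(2)]
    and gV = has_all_moments_component_if_gaussian[OF _ V(2)]
  have "AE \<omega> in M. (\<lambda>N. (\<Sum>i=1..N. U i \<omega> $ a * V i \<omega> $ b) / real N) \<longlonglongrightarrow> \<Gamma> $ a $ b + m $ a * m' $ b" for a b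
  proof (rule strong_law_fourth_moment)
    show "indep_vars (\<lambda>_. borel) (\<lambda>i \<omega>. U i \<omega> $ a * V i \<omega> $ b) {1..}"
      by (rule indep_vars_if_indep_sets[OF indep_H space_H])
        (auto intro!: borel_measurable_times measurable_compose[OF U(1) borel_measurable_vec_nth]
          measurable_compose[OF V(1) borel_measurable_vec_nth])
    fix i :: nat assume i: "i \<ge> 1"
    have mom: "has_all_moments M (\<lambda>\<omega>. U i \<omega> $ a)" "has_all_moments M (\<lambda>\<omega>. V i \<omega> $ b)"
      using i gU(1)[OF _ i] gV(1)[OF _ i] by auto
    show int: "integrable M (\<lambda>\<omega>. (U i \<omega> $ a * V i \<omega> $ b) ^ 4)"
      by (intro has_all_momentsD(2) has_all_moments_mult mom)
    show "expectation (\<lambda>\<omega>. U i \<omega> $ a * V i \<omega> $ b) = \<Gamma> $ a $ b + m $ a * m' $ b"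
      by (rule UV[OF i])
    \<comment> \<open>The bound on the fourth moments has to be uniform in \<open>i\<close>, so it is expressed by the two laws alone.\<close>
    have "(u * v) ^ 4 \<le> u ^ 8 + v ^ 8" for u v :: real
      using abs_le_D1[OF abs_mult_le_sum_squares[of "u ^ 4" "v ^ 4"]]
      by (simp add: power_mult_distrib power_mult[symmetric])
    then have "expectation (\<lambda>\<omega>. (U i \<omega> $ a * V i \<omega> $ b) ^ 4) \<le> expectation (\<lambda>\<omega>. U i \<omega> $ a ^ 8 + V i \<omega> $ b ^ 8)"
      by (intro integral_mono int Bochner_Integration.integrable_add has_all_momentsD(2) mom)
    also have "\<dots> = (\<integral>x. x $ a ^ 8 \<partial>gaussian_measure m P) + (\<integral>x. x $ b ^ 8 \<partial>gaussian_measure m' P')"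
      using gU(2)[OF _ i, of "\<lambda>x. x $ a ^ 8"] gV(2)[OF _ i, of "\<lambda>x. x $ b ^ 8"] i has_all_momentsD(2)[OF mom(1)] has_all_momentsD(2)[OF mom(2)]
      by auto
    finally show "expectation (\<lambda>\<omega>. (U i \<omega> $ a * V i \<omega> $ b) ^ 4)
      \<le> (\<integral>x. x $ a ^ 8 \<partial>gaussian_measure m P) + (\<integral>x. x $ b ^ 8 \<partial>gaussian_measure m' P')" .
  qed
  then have "AE \<omega> in M. \<forall>a b. (\<lambda>N. (\<Sum>i=1..N. U i \<omega> $ a * V i \<omega> $ b) / real N) \<longlonglongrightarrow> \<Gamma> $ a $ b + m $ a * m' $ b"
    unfolding AE_all_countable by blast
  moreover have "AE \<omega> in M. (\<lambda>N. sample_mean N (\<lambda>i. U i \<omega>)) \<longlonglongrightarrow> m"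
    by (rule AE_sample_mean_gaussian[OF U])
  moreover have "AE \<omega> in M. (\<lambda>N. sample_mean N (\<lambda>i. V i \<omega>)) \<longlonglongrightarrow> m'"
    by (rule AE_sample_mean_gaussian[OF V])
  ultimately show ?thesis
    by eventually_elim (rule sample_cross_cov_tendsto, auto)
qed

end


section \<open>The noise of the particle system\<close>

lemma mesh_pos: "mesh l > 0"
  by (simp add: mesh_def)

lemma grid_index_multiple: "grid_index l (real k * mesh l) = k"
  using mesh_pos[of l] by (simp add: grid_index_def)

lemma integral_empirical_measure:
  fixes x :: "nat \<Rightarrow> real^'x"
  shows "(\<integral>z. z \<partial>empirical_measure N x) = sample_mean N x"
  unfolding empirical_measure_def
  by (subst integral_distr)
    (simp_all add: uniform_count_measure_def lebesgue_integral_point_measure_finite sample_mean_def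
      scaleR_sum_right)

lemma generated_algebra_subset_Pow: "generated_algebra M I Z \<subseteq> Pow (space M)"
proof
  fix B assume "B \<in> generated_algebra M I Z"
  then have "B \<subseteq> space M"
    unfolding generated_algebra_def by (rule sigma_sets_into_sp[rotated]) auto
  then show "B \<in> Pow (space M)" by simp
qed

lemma measurable_generated_algebra:
  fixes Z :: "'i \<Rightarrow> 'a \<Rightarrow> 'b::topological_space"
  assumes "t \<in> I"
  shows "Z t \<in> borel_measurable (sigma (space M) (generated_algebra M I Z))"
proof (rule measurableI)
  fix B :: "'b set" assume "B \<in> sets borel"
  then have "Z t -` B \<inter> space M \<in> generated_algebra M I Z"
    using assms unfolding generated_algebra_def by (intro sigma_sets.Basic) auto
  moreover note generated_algebra_subset_Pow[of M I Z]
  ultimately show "Z t -` B \<inter> space (sigma (space M) (generated_algebra M I Z))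
      \<in> sets (sigma (space M) (generated_algebra M I Z))"
    by auto
qed simp

text \<open>In particular each of these families is closed under intersections, as the grouping of
  independent families requires.\<close>

lemma sigma_algebra_source_algebra:
  "sigma_algebra (space M) (source_algebra M X W V Wb Vb \<xi>0 s)"
proof (cases s)
  case Signal
  show ?thesis unfolding Signal source_algebra.simps
    by (intro sigma_algebra_sigma_sets Un_least generated_algebra_subset_Pow)
qed (auto simp: generated_algebra_def intro!: sigma_algebra_sigma_sets)

lemma brownian_increment_law:
  assumes "standard_brownian_motion M W"
  shows "distr M borel (\<lambda>\<omega>. grid_increment l (\<lambda>s. W s \<omega>) j) = gaussian_measure 0 (mesh l *\<^sub>R mat 1)"
proof -
  have "0 \<le> real j * mesh l" "real j * mesh l < real (j + 1) * mesh l"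
    "real (j + 1) * mesh l - real j * mesh l = mesh l"
    using mesh_pos[of l] by (simp_all add: algebra_simps)
  then show ?thesis
    using assms unfolding standard_brownian_motion_def grid_increment_def
    by (elim conjE allE[of _ "real j * mesh l"] allE[of _ "real (j + 1) * mesh l"]) simp
qed

text \<open>The increments over different grid cells are independent and centred.\<close>

lemma (in prob_space) brownian_increments_uncorrelated:
  fixes W :: "real \<Rightarrow> 'a \<Rightarrow> real^'n"
  assumes bm: "standard_brownian_motion M W" and "j \<noteq> j'"
  shows "expectation (\<lambda>\<omega>. grid_increment l (\<lambda>s. W s \<omega>) j $ a * grid_increment l (\<lambda>s. W s \<omega>) j' $ b) = 0"
proof -
  define Z where "Z j \<omega> = grid_increment l (\<lambda>s. W s \<omega>) j" for j \<omega>
  define \<tau> where "\<tau> j = real j * mesh l" for j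
  let ?n = "Suc (max j j')"
  have "mono \<tau>" "0 \<le> \<tau> 0"
    using mesh_pos[of l] by (auto simp: \<tau>_def intro!: monoI mult_right_mono)
  then have "indep_vars (\<lambda>_. borel) (\<lambda>j \<omega>. W (\<tau> (Suc j)) \<omega> - W (\<tau> j) \<omega>) {..<?n}"
    using bm unfolding standard_brownian_motion_def by blast
  then have Z: "indep_vars (\<lambda>_. borel) Z {..<?n}"
    by (simp add: Z_def[abs_def] grid_increment_def \<tau>_def)
  then have [measurable]: "Z i \<in> borel_measurable M" if "i < ?n" for i
    using that by (simp add: indep_vars_def)
  note law = has_all_moments_component_if_gaussian[OF _ brownian_increment_law[OF bm, of l, folded Z_def]]
  have mom: "has_all_moments M (\<lambda>\<omega>. Z i \<omega> $ a)" and mean: "expectation (\<lambda>\<omega>. Z i \<omega> $ a) = 0" if "i < ?n" for i a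
    using law(1)[of i a] law(2)[of i "\<lambda>x. x $ a"] that
      gaussian_measure_moments(4)[of 0 "mesh l *\<^sub>R mat 1" a] by simp_all
  have Zm: "(\<lambda>\<omega>. Z i \<omega> $ a) \<in> borel_measurable (vimage_algebra (space M) (Z i) borel)" for i a
    by (rule measurable_compose[OF measurable_vimage_algebra1 borel_measurable_vec_nth]) simp
  have "expectation (\<lambda>\<omega>. Z j \<omega> $ a * Z j' \<omega> $ b) = expectation (\<lambda>\<omega>. Z j \<omega> $ a) * expectation (\<lambda>\<omega>. Z j' \<omega> $ b)"
  proof (rule expectation_mult_if_indep_sets[where H = "\<lambda>i. vimage_algebra (space M) (Z i) borel" and I = "{..<?n}"])
    show "indep_sets (\<lambda>i. sets (vimage_algebra (space M) (Z i) borel)) {..<?n}"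
      using Z unfolding indep_vars_def2 by (simp add: sets_vimage_algebra2)
  qed (use assms(2) mom[THEN has_all_momentsD(3)] Zm in auto)
  then show ?thesis
    using mean[of j a] mean[of j' b] by (simp add: Z_def)
qed

text \<open>Two groupings of the independent sources are used. Collecting the three sources of each particle
  gives \<open>\<sigma>\<close>-algebras \<open>H i\<close> that are independent over the particles, as the strong law requires.
  Keeping them apart gives the uncorrelatedness of the initial state and the two noises within one particle.\<close>

lemma (in prob_space) AE_enkf_mean_tendsto_kb_mean:
  fixes Wb :: "nat \<Rightarrow> real \<Rightarrow> 'a \<Rightarrow> real^'x" and Vb :: "nat \<Rightarrow> real \<Rightarrow> 'a \<Rightarrow> real^'y" and \<xi>0 :: "nat \<Rightarrow> 'a \<Rightarrow> real^'x"
    and A R1h P0 :: "real^'x^'x" and C :: "real^'x^'y" and R2h :: "real^'y^'y" and m0 :: "real^'x"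
    and Y :: "real \<Rightarrow> 'a \<Rightarrow> real^'y"
  assumes R: "transpose R1h = R1h" "transpose R2h = R2h" "invertible R2h" and P0: "sym_psd P0"
    and Wb: "\<And>i. i \<ge> 1 \<Longrightarrow> standard_brownian_motion M (Wb i)"
    and Vb: "\<And>i. i \<ge> 1 \<Longrightarrow> standard_brownian_motion M (Vb i)"
    and \<xi>0: "\<And>i. i \<ge> 1 \<Longrightarrow> distr M borel (\<xi>0 i) = gaussian_measure m0 P0"
    and indep: "indep_sets (source_algebra M X W V Wb Vb \<xi>0) (State_Noise ` {1..} \<union> Obs_Noise ` {1..} \<union> Initial ` {1..})"
  shows "AE \<omega> in M. \<forall>k.
    (\<lambda>N. sample_mean N (enkf_particles A C R1h R2h l N (\<lambda>s. Y s \<omega>) (\<lambda>i s. Wb i s \<omega>) (\<lambda>i s. Vb i s \<omega>) (\<lambda>i. \<xi>0 i \<omega>) k))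
      \<longlonglongrightarrow> kb_mean A C R1h R2h m0 P0 l (\<lambda>s. Y s \<omega>) k"
proof -
  let ?E = "source_algebra M X W V Wb Vb \<xi>0"
  let ?I = "State_Noise ` {1..} \<union> Obs_Noise ` {1..} \<union> Initial ` {1..} :: source set"
  define K where "K i = {State_Noise i, Obs_Noise i, Initial i}" for i
  define Hs where "Hs s = sigma (space M) (?E s)" for s
  define H where "H i = sigma (space M) (\<Union>s\<in>K i. ?E s)" for i
  have E_Pow: "?E s \<subseteq> Pow (space M)" for s
    using sigma_algebra_source_algebra[of M X W V Wb Vb \<xi>0 s] by (simp add: sigma_algebra_iff2)
  have sets_Hs: "sets (Hs s) = ?E s" for s
    unfolding Hs_def using E_Pow sigma_algebra.sigma_sets_eq[OF sigma_algebra_source_algebra] by simp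
  have space_Hs: "space (Hs s) = space M" for s by (simp add: Hs_def space_measure_of_conv)
  have indep_Hs: "indep_sets (\<lambda>s. sets (Hs s)) ?I" using indep by (simp add: sets_Hs)
  have K: "(\<Union>i\<in>{1..}. K i) = ?I" by (auto simp: K_def)
  interpret independent_copies M H
  proof
    have "indep_sets (\<lambda>i. sigma_sets (space M) (\<Union>s\<in>K i. ?E s)) {1..}"
    proof (rule indep_sets_collect_sigma)
      show "indep_sets ?E (\<Union>i\<in>{1..}. K i)" unfolding K by (rule indep)
      show "Int_stable (?E s)" for s
        unfolding sets_Hs[symmetric] by (simp add: Int_stable_def sets.Int)
      show "disjoint_family_on K {1..}" by (auto simp: disjoint_family_on_def K_def)
    qed
    then show "indep_sets (\<lambda>i. sets (H i)) {1..}"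
      using E_Pow by (simp add: H_def sets_measure_of UN_subset_iff)
    show "space (H i) = space M" for i by (simp add: H_def space_measure_of_conv)
  qed
  have Hs_H: "f \<in> measurable (H i) L" if "f \<in> measurable (Hs s) L" "s \<in> K i" for f :: "'a \<Rightarrow> 'z" and L s i
  proof -
    have "?E s \<subseteq> (\<Union>s\<in>K i. ?E s)" using that(2) by blast
    with E_Pow have "measurable (Hs s) L \<subseteq> measurable (H i) L"
      unfolding H_def Hs_def by (intro measurable_mono1) blast+
    with that(1) show ?thesis by blast
  qed
  define dW where "dW j i \<omega> = grid_increment l (\<lambda>s. Wb i s \<omega>) j" for j i \<omega>
  define dV where "dV j i \<omega> = grid_increment l (\<lambda>s. Vb i s \<omega>) j" for j i \<omega>
  have dW_Hs: "dW j i \<in> borel_measurable (Hs (State_Noise i))"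
    and dV_Hs: "dV j i \<in> borel_measurable (Hs (Obs_Noise i))"
    and \<xi>_Hs: "\<xi>0 i \<in> borel_measurable (Hs (Initial i))" for i j
    unfolding dW_def[abs_def] dV_def[abs_def] grid_increment_def Hs_def
    using mesh_pos[of l] by (auto intro!: borel_measurable_diff measurable_generated_algebra)
  note H = dW_Hs[THEN Hs_H] dV_Hs[THEN Hs_H] \<xi>_Hs[THEN Hs_H]
  have dW_H: "dW j i \<in> borel_measurable (H i)" and dV_H: "dV j i \<in> borel_measurable (H i)"
    and \<xi>_H: "\<xi>0 i \<in> borel_measurable (H i)" for i j
    using H by (auto simp: K_def)
  let ?\<Delta> = "mesh l *\<^sub>R mat 1"
  have dW_law: "distr M borel (dW j i) = gaussian_measure 0 ?\<Delta>" if "i \<ge> 1" for i j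
    unfolding dW_def[abs_def] by (rule brownian_increment_law[OF Wb[OF that]])
  have dV_law: "distr M borel (dV j i) = gaussian_measure 0 ?\<Delta>" if "i \<ge> 1" for i j
    unfolding dV_def[abs_def] by (rule brownian_increment_law[OF Vb[OF that]])
  have \<Delta>_factor: "\<exists>L :: real^'n^'n. L ** transpose L = ?\<Delta>"
    using mesh_pos[of l] by (intro scalar_matrix_factorization) simp
  have cov: "expectation (\<lambda>\<omega>. U \<omega> $ a * U \<omega> $ b) = P $ a $ b + m $ a * m $ b"
    if "U \<in> borel_measurable (H i)" "distr M borel U = gaussian_measure m P" "i \<ge> 1"
      "\<exists>L :: real^'n^'n. L ** transpose L = P" for U :: "'a \<Rightarrow> real^'n" and i m P a b
    using has_all_moments_component_if_gaussian(2)[OF measurable_H[OF that(3,1)] that(2), of "\<lambda>x. x $ a * x $ b"]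
      gaussian_measure_moments(6)[OF that(4)] by simp
  have uncor: "expectation (\<lambda>\<omega>. U \<omega> $ a * Z \<omega> $ b) = 0 $ a $ b + m $ a * m' $ b"
    if "U \<in> borel_measurable (Hs s)" "distr M borel U = gaussian_measure m P"
      "Z \<in> borel_measurable (Hs s')" "distr M borel Z = gaussian_measure m' P'"
      "i \<ge> 1" "s \<in> K i" "s' \<in> K i" "s \<noteq> s'"
    for U :: "'a \<Rightarrow> real^'n" and Z :: "'a \<Rightarrow> real^'m" and i m m' P P' a b s s'
  proof -
    have M: "U \<in> borel_measurable M" "Z \<in> borel_measurable M"
      using that by (auto intro: measurable_H Hs_H)
    have "expectation (\<lambda>\<omega>. U \<omega> $ a * Z \<omega> $ b) = expectation (\<lambda>\<omega>. U \<omega> $ a) * expectation (\<lambda>\<omega>. Z \<omega> $ b)"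
    proof (rule expectation_mult_if_indep_sets[OF indep_Hs space_Hs])
      show "s \<in> ?I" "s' \<in> ?I" using that K by blast+
      show "s \<noteq> s'" by fact
    qed (use that M in \<open>auto intro: measurable_compose[OF _ borel_measurable_vec_nth]
           has_all_momentsD(3) has_all_moments_component_if_gaussian(1)\<close>)
    then show ?thesis
      using has_all_moments_component_if_gaussian(2)[OF M(1) that(2), of "\<lambda>x. x $ a"]
        has_all_moments_component_if_gaussian(2)[OF M(2) that(4), of "\<lambda>x. x $ b"]
      by (simp add: gaussian_measure_moments(4))
  qed
  have "AE \<omega> in M. (\<lambda>N. sample_mean N (\<lambda>i. \<xi>0 i \<omega>)) \<longlonglongrightarrow> m0"
    by (rule AE_sample_mean_gaussian[OF \<xi>_H \<xi>0])
  moreover have "AE \<omega> in M. \<forall>j. (\<lambda>N. sample_mean N (\<lambda>i. dW j i \<omega>)) \<longlonglongrightarrow> 0"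
    unfolding AE_all_countable by (intro allI AE_sample_mean_gaussian[OF dW_H dW_law])
  moreover have "AE \<omega> in M. \<forall>j. (\<lambda>N. sample_mean N (\<lambda>i. dV j i \<omega>)) \<longlonglongrightarrow> 0"
    unfolding AE_all_countable by (intro allI AE_sample_mean_gaussian[OF dV_H dV_law])
  moreover have "AE \<omega> in M. (\<lambda>N. sample_cross_cov N (\<lambda>i. \<xi>0 i \<omega>) (\<lambda>i. \<xi>0 i \<omega>)) \<longlonglongrightarrow> P0"
    by (rule AE_sample_cross_cov_gaussian[OF \<xi>_H \<xi>0 \<xi>_H \<xi>0 cov[OF \<xi>_H \<xi>0]])
      (use sym_psd_factorization[OF P0] in auto)
  moreover have "AE \<omega> in M. \<forall>j. (\<lambda>N. sample_cross_cov N (\<lambda>i. \<xi>0 i \<omega>) (\<lambda>i. dW j i \<omega>)) \<longlonglongrightarrow> 0"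
    unfolding AE_all_countable
    by (intro allI AE_sample_cross_cov_gaussian[OF \<xi>_H \<xi>0 dW_H dW_law] uncor[OF \<xi>_Hs \<xi>0 dW_Hs dW_law])
      (auto simp: K_def)
  moreover have "AE \<omega> in M. \<forall>j. (\<lambda>N. sample_cross_cov N (\<lambda>i. \<xi>0 i \<omega>) (\<lambda>i. dV j i \<omega>)) \<longlonglongrightarrow> 0"
    unfolding AE_all_countable
    by (intro allI AE_sample_cross_cov_gaussian[OF \<xi>_H \<xi>0 dV_H dV_law] uncor[OF \<xi>_Hs \<xi>0 dV_Hs dV_law])
      (auto simp: K_def)
  moreover have "AE \<omega> in M. \<forall>j j'. (\<lambda>N. sample_cross_cov N (\<lambda>i. dW j i \<omega>) (\<lambda>i. dV j' i \<omega>)) \<longlonglongrightarrow> 0"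
    unfolding AE_all_countable
    by (intro allI AE_sample_cross_cov_gaussian[OF dW_H dW_law dV_H dV_law] uncor[OF dW_Hs dW_law dV_Hs dV_law])
      (auto simp: K_def)
  moreover have "AE \<omega> in M. \<forall>j j'. (\<lambda>N. sample_cross_cov N (\<lambda>i. dW j i \<omega>) (\<lambda>i. dW j' i \<omega>))
      \<longlonglongrightarrow> (if j = j' then ?\<Delta> else 0)"
    unfolding AE_all_countable
  proof (intro allI AE_sample_cross_cov_gaussian[OF dW_H dW_law dW_H dW_law])
    show "expectation (\<lambda>\<omega>. dW j i \<omega> $ a * dW j' i \<omega> $ b) = (if j = j' then ?\<Delta> else 0) $ a $ b + 0 $ a * 0 $ b"
      if "i \<ge> 1" for j j' i a b
      using cov[OF dW_H dW_law[OF that] that \<Delta>_factor] brownian_increments_uncorrelated[OF Wb[OF that]]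
      by (cases "j = j'") (auto simp: dW_def)
  qed
  moreover have "AE \<omega> in M. \<forall>j j'. (\<lambda>N. sample_cross_cov N (\<lambda>i. dV j i \<omega>) (\<lambda>i. dV j' i \<omega>))
      \<longlonglongrightarrow> (if j = j' then ?\<Delta> else 0)"
    unfolding AE_all_countable
  proof (intro allI AE_sample_cross_cov_gaussian[OF dV_H dV_law dV_H dV_law])
    show "expectation (\<lambda>\<omega>. dV j i \<omega> $ a * dV j' i \<omega> $ b) = (if j = j' then ?\<Delta> else 0) $ a $ b + 0 $ a * 0 $ b"
      if "i \<ge> 1" for j j' i a b
      using cov[OF dV_H dV_law[OF that] that \<Delta>_factor] brownian_increments_uncorrelated[OF Vb[OF that]]
      by (cases "j = j'") (auto simp: dV_def)
  qed
  ultimately show ?thesis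
  proof eventually_elim
    case (elim \<omega>)
    show ?case
      by (intro allI enkf_mean_tendsto_kb_mean[where dw = "\<lambda>j i. dW j i \<omega>" and dv = "\<lambda>j i. dV j i \<omega>", OF R])
        (use elim in \<open>auto simp: dW_def dV_def\<close>)
  qed
qed

theorem proposition2p1:
  fixes M :: "'a measure"
    and A R1h P0 :: "real^'x^'x" and C :: "real^'x^'y" and R2h :: "real^'y^'y"
    and m0 :: "real^'x"
    and X W :: "real \<Rightarrow> 'a \<Rightarrow> real^'x" and Y V :: "real \<Rightarrow> 'a \<Rightarrow> real^'y"
    and Wb :: "nat \<Rightarrow> real \<Rightarrow> 'a \<Rightarrow> real^'x" and Vb :: "nat \<Rightarrow> real \<Rightarrow> 'a \<Rightarrow> real^'y"
    and \<xi>0 :: "nat \<Rightarrow> 'a \<Rightarrow> real^'x"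
    and l k1 :: nat and t :: real
  assumes "prob_space M"
    and "transpose R1h = R1h" and "invertible R1h"
    and "transpose R2h = R2h" and "invertible R2h"
    and "sym_psd P0"
    and "standard_brownian_motion M (joint_process V W)"
    and "prob_space.indep_set M (generated_algebra M {0..} (joint_process V W))
           (generated_algebra M {0} X)"
    and "distr M borel (X 0) = gaussian_measure m0 P0"
    and "signal_observation M A C R1h R2h W V X Y"
    and "\<And>i. i \<ge> 1 \<Longrightarrow> standard_brownian_motion M (Wb i)"
    and "\<And>i. i \<ge> 1 \<Longrightarrow> standard_brownian_motion M (Vb i)"
    and "\<And>i. i \<ge> 1 \<Longrightarrow> \<xi>0 i \<in> borel_measurable M"
    and "\<And>i. i \<ge> 1 \<Longrightarrow> distr M borel (\<xi>0 i) = gaussian_measure m0 P0"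
    and "prob_space.indep_sets M (source_algebra M X W V Wb Vb \<xi>0)
           ({Signal} \<union> State_Noise ` {1..} \<union> Obs_Noise ` {1..} \<union> Initial ` {1..})"
    and "log_norm A < 0"
    and "\<exists>c. \<forall>k l' j1 j2. \<bar>kb_cov A C R1h R2h P0 l' k $ j1 $ j2\<bar> \<le> c"
    and "t \<ge> 0" and "\<exists>k :: nat. t = real k * mesh l"
    and "real k1 \<le> 1 / mesh l"
  shows "AE \<omega> in M.
    (\<lambda>N. (\<integral>x. x \<partial>enkf_law A C R1h R2h l N (\<lambda>s. Y s \<omega>) (\<lambda>i s. Wb i s \<omega>) (\<lambda>i s. Vb i s \<omega>)
                   (\<lambda>i. \<xi>0 i \<omega>) (t + real k1 * mesh l))
        - (\<integral>x. x \<partial>kb_law A C R1h R2h m0 P0 l (\<lambda>s. Y s \<omega>) (t + real k1 * mesh l)))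
      \<longlonglongrightarrow> 0"
proof -
  interpret prob_space M by fact
  obtain k :: nat where k: "t = real k * mesh l" using assms(19) by blast
  have idx: "grid_index l (t + real k1 * mesh l) = k + k1"
    using grid_index_multiple[of l "k + k1"] by (simp add: k algebra_simps)
  have "indep_sets (source_algebra M X W V Wb Vb \<xi>0) (State_Noise ` {1..} \<union> Obs_Noise ` {1..} \<union> Initial ` {1..})"
    by (rule indep_sets_mono_index[OF _ assms(15)]) auto
  then have "AE \<omega> in M. \<forall>k.
    (\<lambda>N. sample_mean N (enkf_particles A C R1h R2h l N (\<lambda>s. Y s \<omega>) (\<lambda>i s. Wb i s \<omega>) (\<lambda>i s. Vb i s \<omega>) (\<lambda>i. \<xi>0 i \<omega>) k))
      \<longlonglongrightarrow> kb_mean A C R1h R2h m0 P0 l (\<lambda>s. Y s \<omega>) k"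
    by (intro AE_enkf_mean_tendsto_kb_mean[OF assms(2,4,5,6,11,12,14)])
  then show ?thesis
  proof eventually_elim
    case (elim \<omega>)
    then show ?case
      unfolding enkf_law_def kb_law_def idx integral_empirical_measure gaussian_measure_moments(5)
      by (intro tendsto_eq_intros) auto
  qed
qed

end
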